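(* Let $(X,T)$ be a minimal Cantor system and let $p:X\to\mathbb{Z}^+$ be a bounded function such that $S(x)=T^{p(x)}(x)$ defines a homeomorphism $S:X\to X$. If $M(X,T)=M(X,S)$, then $$h(S)=c\cdot h(T),$$ where $c$ is the orbit number of the speedup.
   Context: A minimal Cantor system is a pair $(X,T)$ with $X$ a Cantor space and $T:X\to X$ a homeomorphism all of whose orbits are dense. $h(\cdot)$ denotes topological entropy; $M(X,T)$ and $M(X,S)$ denote the sets of $T$-invariant and $S$-invariant Borel probability measures on $X$. Orbit number: for such a bounded speedup $S$ of $T$, there is a constant $c\in\mathbb{Z}^+$ such that every $T$-orbit is the union of exactly $c$ different $S$-orbits; $c$ is called the orbit number. *)

theory Defs
  imports "HOL-Probability.Probability"
begin

text \<open>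
  The space \<open>X\<close> is a type of class \<^class>\<open>topological_space\<close>. The type \<open>nat \<Rightarrow> bool\<close> carries the
  product of the discrete topologies, that is, it is the Cantor set.
\<close>

definition cantor_space :: "'a::topological_space itself \<Rightarrow> bool" where
  "cantor_space _ \<longleftrightarrow> (UNIV :: 'a set) homeomorphic (UNIV :: (nat \<Rightarrow> bool) set)"

definition self_homeomorphism :: "('a::topological_space \<Rightarrow> 'a) \<Rightarrow> bool" where
  "self_homeomorphism T \<longleftrightarrow> (\<exists>g. homeomorphism UNIV UNIV T g)"

definition full_orbit :: "('a \<Rightarrow> 'a) \<Rightarrow> 'a \<Rightarrow> 'a set" where
  "full_orbit T x = range (\<lambda>n. (T ^^ n) x) \<union> range (\<lambda>n. (inv T ^^ n) x)"

definition minimal_cantor_system :: "('a::topological_space \<Rightarrow> 'a) \<Rightarrow> bool" where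
  "minimal_cantor_system T \<longleftrightarrow>
     cantor_space TYPE('a) \<and> self_homeomorphism T \<and> (\<forall>x. closure (full_orbit T x) = UNIV)"

definition invariant_measures :: "('a::topological_space \<Rightarrow> 'a) \<Rightarrow> 'a measure set" where
  "invariant_measures T =
     {\<mu>. prob_space \<mu> \<and> sets \<mu> = sets borel \<and>
          (\<forall>A\<in>sets borel. emeasure \<mu> (T -` A) = emeasure \<mu> A)}"

definition is_orbit_number :: "('a \<Rightarrow> 'a) \<Rightarrow> ('a \<Rightarrow> 'a) \<Rightarrow> nat \<Rightarrow> bool" where
  "is_orbit_number T S c \<longleftrightarrow>
     c > 0 \<and> (\<forall>x. \<exists>\<O>. \<O> \<subseteq> range (full_orbit S) \<and> card \<O> = c \<and> \<Union>\<O> = full_orbit T x)"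

text \<open>
  Orbits of a bijection are pairwise disjoint, so the family \<open>\<O>\<close> above is determined by \<open>x\<close> and at
  most one \<open>c\<close> qualifies; for a bounded speedup of a minimal Cantor system one exists.
\<close>

definition orbit_number :: "('a \<Rightarrow> 'a) \<Rightarrow> ('a \<Rightarrow> 'a) \<Rightarrow> nat" where
  "orbit_number T S = (THE c. is_orbit_number T S c)"

text \<open>
  Topological entropy of a continuous self-map of a compact space, following Adler, Konheim and
  McAndrew: \<open>min_subcover \<U>\<close> is the least cardinality of a subcover of the open cover \<open>\<U>\<close>, and
  \<open>iterated_join T \<U> n\<close> is the common refinement of the covers \<open>T\<^sup>-\<^sup>i \<U>\<close> for \<open>i < n\<close>. The limit
  exists by subadditivity; the value is extended real since entropy may be infinite.
\<close>

definition open_covers :: "'a::topological_space set set set" where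
  "open_covers = {\<U>. (\<forall>U\<in>\<U>. open U) \<and> \<Union>\<U> = UNIV}"

definition min_subcover :: "'a set set \<Rightarrow> nat" where
  "min_subcover \<U> = (LEAST k. \<exists>\<V>\<subseteq>\<U>. finite \<V> \<and> card \<V> = k \<and> \<Union>\<V> = UNIV)"

definition iterated_join :: "('a \<Rightarrow> 'a) \<Rightarrow> 'a set set \<Rightarrow> nat \<Rightarrow> 'a set set" where
  "iterated_join T \<U> n = {(\<Inter>i<n. (T ^^ i) -` A i) | A. \<forall>i<n. A i \<in> \<U>}"

definition cover_entropy :: "('a \<Rightarrow> 'a) \<Rightarrow> 'a set set \<Rightarrow> ereal" where
  "cover_entropy T \<U> = lim (\<lambda>n. ereal (ln (real (min_subcover (iterated_join T \<U> n))) / real n))"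

definition topological_entropy :: "('a::topological_space \<Rightarrow> 'a) \<Rightarrow> ereal" where
  "topological_entropy T = (SUP \<U>\<in>open_covers. cover_entropy T \<U>)"

end

theory Submission
  imports Defs
begin

text \<open>
  The idea is that, in the long run, one step of \<open>S\<close> is worth exactly \<open>c\<close> steps of \<open>T\<close>, uniformly in
  the starting point, and that topological entropy scales accordingly.

  On each \<open>T\<close>-orbit, which is a copy of the integers, \<open>S\<close> jumps forward. Every \<open>S\<close>-orbit in it jumps
  exactly once over the cut between \<open>x\<close> and \<open>T x\<close>; hence the orbit number \<open>c\<close> is the number of
  jumps over a cut (\<open>orbit_number_eq\<close>). This number does not depend on \<open>x\<close>, being locally constant and
  \<open>T\<close>-invariant (\<open>crossing_card_eq\<close>). Integrating it gives \<open>\<integral> p d\<mu> = c\<close> for every \<open>T\<close>-invariant \<open>\<mu>\<close>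
  (\<open>kac_formula\<close>).

  If \<open>T\<close> and \<open>S\<close> have the same invariant measures, then \<open>\<integral> p d\<mu> = c\<close> for every \<open>S\<close>-invariant \<open>\<mu>\<close>
  too. By the argument of Krylov and Bogoliubov, the averages of \<open>p\<close> along \<open>S\<close> then converge to \<open>c\<close>
  uniformly (\<open>uniform_visit_frequencies\<close>). Writing \<open>S\<^sup>n x = T\<^sup>t x\<close> with \<open>t = time n x\<close>, this says that
  the minimum and the maximum over \<open>x\<close> of \<open>time n x\<close> are both asymptotic to \<open>c n\<close>
  (\<open>extremal_time_limits\<close>).

  Finally, the function \<open>p\<close> is locally constant, so open covers may be refined until itineraries
  record the values of \<open>p\<close>. A \<open>T\<close>-itinerary of length \<open>max (time n)\<close> then determines an \<open>S\<close>-itinerary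
  of length \<open>n\<close>, and an \<open>S\<close>-itinerary of length \<open>n\<close> determines a \<open>T\<close>-itinerary of length \<open>min (time n)\<close>
  (\<open>T_join_refines_S_join\<close>, \<open>S_join_refines_T_join\<close>). Comparing the growth rates of the minimal
  subcovers gives both inequalities between \<open>h(S)\<close> and \<open>c h(T)\<close>.
\<close>

section \<open>Cantor spaces and their clopen sets\<close>

definition clopen :: "'a::topological_space set \<Rightarrow> bool" where
  "clopen A \<longleftrightarrow> open A \<and> closed A"

lemma clopen_UNIV: "clopen UNIV" and clopen_empty: "clopen {}"
  by (auto simp: clopen_def)

lemma clopen_Int: "clopen A \<Longrightarrow> clopen B \<Longrightarrow> clopen (A \<inter> B)"
  and clopen_Un: "clopen A \<Longrightarrow> clopen B \<Longrightarrow> clopen (A \<union> B)"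
  and clopen_Compl: "clopen A \<Longrightarrow> clopen (- A)"
  and clopen_Diff: "clopen A \<Longrightarrow> clopen B \<Longrightarrow> clopen (A - B)"
  by (auto simp: clopen_def open_Diff closed_Diff)

lemma clopen_INT: "finite I \<Longrightarrow> (\<And>i. i \<in> I \<Longrightarrow> clopen (A i)) \<Longrightarrow> clopen (\<Inter>i\<in>I. A i)"
  and clopen_UN: "finite I \<Longrightarrow> (\<And>i. i \<in> I \<Longrightarrow> clopen (A i)) \<Longrightarrow> clopen (\<Union>i\<in>I. A i)"
  by (auto simp: clopen_def)

lemma clopen_vimage: "continuous_on UNIV f \<Longrightarrow> clopen A \<Longrightarrow> clopen (f -` A)"
  by (auto simp: clopen_def open_vimage closed_vimage)

lemma continuous_funpow:
  fixes f :: "'a::topological_space \<Rightarrow> 'a"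
  assumes "continuous_on UNIV f"
  shows "continuous_on UNIV (f ^^ n)"
proof (induction n)
  case (Suc n)
  show ?case
    using continuous_on_compose[of UNIV "f ^^ n" f] Suc continuous_on_subset[OF assms] by simp
qed (simp add: id_def)

lemma self_homeomorphismD:
  assumes "self_homeomorphism T"
  shows "continuous_on UNIV T" "continuous_on UNIV (inv T)" "bij T"
proof -
  obtain g where g: "homeomorphism UNIV UNIV T g"
    using assms by (auto simp: self_homeomorphism_def)
  then have "\<And>x. g (T x) = x" "\<And>y. T (g y) = y"
    by (auto simp: homeomorphism_def)
  moreover from this show "bij T"
    by (intro bijI') metis+
  ultimately have "inv T = g"
    by (metis bij_inv_eq_iff ext)
  with g show "continuous_on UNIV T" "continuous_on UNIV (inv T)"
    by (auto simp: homeomorphism_def)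
qed

text \<open>
  A basic open set of the product restricts only finitely many coordinates, all of them below some \<open>n\<close>.
\<close>

lemma bool_sequence_cylinder_basis:
  fixes U :: "(nat \<Rightarrow> bool) set"
  assumes "open U" "x \<in> U"
  shows "\<exists>n. {y. \<forall>i<n. y i = x i} \<subseteq> U"
proof -
  obtain X where X: "x \<in> (\<Pi>\<^sub>E i\<in>UNIV. X i)" "finite {i. X i \<noteq> UNIV}" "(\<Pi>\<^sub>E i\<in>UNIV. X i) \<subseteq> U"
    using product_topology_open_contains_basis[of "\<lambda>_. euclidean" UNIV U x] assms
    by (auto simp: open_fun_def)
  obtain n where n: "{i. X i \<noteq> UNIV} \<subseteq> {..<n}"
    using X(2) finite_nat_iff_bounded by blast
  have "{y. \<forall>i<n. y i = x i} \<subseteq> (\<Pi>\<^sub>E i\<in>UNIV. X i)"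
  proof
    fix y assume "y \<in> {y. \<forall>i<n. y i = x i}"
    then have "y i \<in> X i" for i
      using X(1) n by (cases "i < n") (force simp: PiE_def Pi_def subset_iff)+
    then show "y \<in> (\<Pi>\<^sub>E i\<in>UNIV. X i)" by auto
  qed
  with X(3) show ?thesis by blast
qed

lemma cantor_space_compact:
  assumes "cantor_space TYPE('a::topological_space)"
  shows "compact (UNIV :: 'a set)"
proof -
  have "compact (UNIV :: bool set)" by (simp add: finite_imp_compact)
  then have "compact (UNIV :: (nat \<Rightarrow> bool) set)"
    using compact_space_product_topology[of "\<lambda>_::nat. euclidean :: bool topology" UNIV]
    by (simp add: euclidean_product_topology compact_space_def)
  then show ?thesis
    using assms homeomorphic_compactness unfolding cantor_space_def by blast
qed

lemma cantor_space_infinite: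
  assumes "cantor_space TYPE('a::topological_space)"
  shows "infinite (UNIV :: 'a set)"
proof -
  have "infinite (UNIV :: (nat \<Rightarrow> bool) set)"
    by (simp add: finite_UNIV_fun)
  moreover obtain f :: "'a \<Rightarrow> nat \<Rightarrow> bool" where "range f = UNIV"
    using assms unfolding cantor_space_def homeomorphic_def homeomorphism_def by blast
  ultimately show ?thesis
    using finite_imageI[of "UNIV :: 'a set" f] by auto
qed

text \<open>
  The coordinates separate points and their cylinders form a countable clopen basis. These are the two
  forms in which the Hausdorff property and second countability are used.
\<close>

lemma cantor_space_coordinates:
  assumes "cantor_space TYPE('a::topological_space)"
  obtains e :: "'a::topological_space \<Rightarrow> nat \<Rightarrow> bool" where
    "inj e" "\<And>n b. clopen {x. e x n = b}"
    "\<And>U x. open U \<Longrightarrow> x \<in> U \<Longrightarrow> \<exists>n. {y. \<forall>i<n. e y i = e x i} \<subseteq> U"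
proof -
  obtain e :: "'a \<Rightarrow> nat \<Rightarrow> bool" and g where h: "homeomorphism UNIV UNIV e g"
    using assms by (auto simp: cantor_space_def homeomorphic_def)
  then have ge: "\<And>x. g (e x) = x" and eg: "\<And>y. e (g y) = y"
    and ce: "continuous_on UNIV e" and cg: "continuous_on UNIV g"
    by (auto simp: homeomorphism_def)
  show thesis
  proof
    show "inj e" using ge by (metis injI)
    show "clopen {x. e x n = b}" for n b
    proof -
      have "clopen ((\<lambda>x. e x n) -` {b})"
        by (intro clopen_vimage continuous_on_product_then_coordinatewise[OF ce])
           (simp add: clopen_def closed_def discrete_topology_class.open_discrete)
      then show ?thesis by (simp add: vimage_def)
    qed
    show "\<exists>n. {y. \<forall>i<n. e y i = e x i} \<subseteq> U" if "open U" "x \<in> U" for U x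
    proof -
      have "open (g -` U)" "e x \<in> g -` U"
        using that cg ge by (auto simp: open_vimage)
      then obtain n where "{y. \<forall>i<n. y i = e x i} \<subseteq> g -` U"
        using bool_sequence_cylinder_basis by blast
      then have "g (e y) \<in> U" if "\<forall>i<n. e y i = e x i" for y
        using that by blast
      then show ?thesis unfolding ge by blast
    qed
  qed
qed

lemma cantor_space_closed_equalizer:
  fixes f g :: "'a::topological_space \<Rightarrow> 'a"
  assumes "cantor_space TYPE('a)" "continuous_on UNIV f" "continuous_on UNIV g"
  shows "closed {x. f x = g x}"
proof -
  obtain e :: "'a \<Rightarrow> nat \<Rightarrow> bool" where e: "inj e" "\<And>n b. clopen {x. e x n = b}"
    using cantor_space_coordinates[OF assms(1)] by metis
  have "f x = g x \<longleftrightarrow> (\<forall>n. e (f x) n = e (g x) n)" for x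
    using inj_eq[OF e(1), of "f x" "g x"] by (simp add: fun_eq_iff)
  then have "{x. f x = g x} = (\<Inter>n. \<Union>b. f -` {x. e x n = b} \<inter> g -` {x. e x n = b})"
    by auto
  moreover have "clopen (f -` {x. e x n = b} \<inter> g -` {x. e x n = b})" for n b
    by (intro clopen_Int clopen_vimage assms e)
  then have "clopen (\<Union>b. f -` {x. e x n = b} \<inter> g -` {x. e x n = b})" for n
    by (intro clopen_UN) auto
  ultimately show ?thesis
    by (metis (mono_tags, lifting) closed_INT clopen_def)
qed

lemma cantor_space_closed_singleton:
  assumes "cantor_space TYPE('a::topological_space)"
  shows "closed {x :: 'a}"
  using cantor_space_closed_equalizer[OF assms continuous_on_id continuous_on_const, of x] by simp

text \<open>
  This is what lets a measure be constructed, and invariance be tested, on clopen sets alone.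
\<close>

lemma cantor_space_borel_eq:
  assumes "cantor_space TYPE('a::topological_space)"
  shows "sets (borel :: 'a measure) = sigma_sets UNIV (Collect clopen)"
  unfolding borel_def
proof (subst sets_measure_of, simp, rule sigma_sets_eqI)
  fix U :: "'a set" assume "U \<in> {S. open S}"
  then have U: "open U" by simp
  obtain e :: "'a \<Rightarrow> nat \<Rightarrow> bool" where e: "\<And>n b. clopen {x. e x n = b}"
    "\<And>U x. open U \<Longrightarrow> x \<in> U \<Longrightarrow> \<exists>n. {y. \<forall>i<n. e y i = e x i} \<subseteq> U"
    by (rule cantor_space_coordinates[OF assms]) blast
  \<comment> \<open>There are only countably many cylinders, since each is given by a finite word.\<close>
  define C where "C w = {y. \<forall>i<length w. e y i = w ! i}" for w :: "bool list"
  have C: "clopen (C w)" for w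
  proof -
    have "C w = (\<Inter>i\<in>{..<length w}. {y. e y i = w ! i})" by (auto simp: C_def)
    then show ?thesis using clopen_INT[of "{..<length w}" "\<lambda>i. {y. e y i = w ! i}"] e(1) by simp
  qed
  have "U = \<Union>(C ` {w. C w \<subseteq> U})"
  proof (intro equalityI subsetI)
    fix x assume "x \<in> U"
    then obtain n where n: "{y. \<forall>i<n. e y i = e x i} \<subseteq> U" using e(2) U by blast
    let ?w = "map (e x) [0..<n]"
    have "x \<in> C ?w" "C ?w \<subseteq> U" using n by (auto simp: C_def)
    then show "x \<in> \<Union>(C ` {w. C w \<subseteq> U})" by blast
  qed auto
  also have "\<dots> \<in> sigma_sets UNIV (Collect clopen)"
    by (rule sigma_sets_UNION) (use C in \<open>auto intro: sigma_sets.Basic\<close>)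
  finally show "U \<in> sigma_sets UNIV (Collect clopen)" .
qed (auto simp: clopen_def)

section \<open>Orbits of a speedup\<close>

lemma full_orbit_iff:
  assumes "bij f"
  shows "y \<in> full_orbit f x \<longleftrightarrow> (\<exists>n. (f ^^ n) x = y) \<or> (\<exists>n. (f ^^ n) y = x)"
proof -
  have "y = (inv f ^^ n) x \<longleftrightarrow> (f ^^ n) y = x" for n
    using inj_fn[of f n] assms inv_fn[OF assms, of n] bij_fn[OF assms, of n]
    by (metis bij_inv_eq_iff)
  then show ?thesis
    by (auto simp: full_orbit_def)
qed

lemma full_orbit_refl: "x \<in> full_orbit f x"
  unfolding full_orbit_def by (intro UnI1 range_eqI[of _ _ 0]) simp

lemma full_orbit_sym: "bij f \<Longrightarrow> y \<in> full_orbit f x \<Longrightarrow> x \<in> full_orbit f y"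
  by (auto simp: full_orbit_iff)

lemma funpow_eq_cancel:
  assumes "inj f" "(f ^^ m) x = (f ^^ n) y" "m \<le> n"
  shows "x = (f ^^ (n - m)) y"
proof -
  have "(f ^^ m) x = (f ^^ m) ((f ^^ (n - m)) y)"
    using assms funpow_add[of m "n - m" f] by simp
  then show ?thesis
    using inj_fn[OF assms(1), of m] by (simp add: inj_eq)
qed

lemma full_orbit_trans:
  assumes "bij f" "y \<in> full_orbit f x" "z \<in> full_orbit f y"
  shows "z \<in> full_orbit f x"
proof -
  have f: "inj f" using assms(1) by (rule bij_is_inj)
  consider n m where "(f ^^ n) x = y" "(f ^^ m) y = z" | n m where "(f ^^ n) x = y" "(f ^^ m) z = y"
    | n m where "(f ^^ n) y = x" "(f ^^ m) y = z" | n m where "(f ^^ n) y = x" "(f ^^ m) z = y"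
    using assms by (auto simp: full_orbit_iff)
  then show ?thesis
  proof cases
    case 1
    then have "(f ^^ (m + n)) x = z" by (simp add: funpow_add)
    then show ?thesis using assms(1) by (auto simp: full_orbit_iff)
  next
    case (2 n m)
    then show ?thesis
      using funpow_eq_cancel[OF f, of n x m z] funpow_eq_cancel[OF f, of m z n x]
      by (cases "n \<le> m") (auto simp: full_orbit_iff[OF assms(1)])
  next
    case (3 n m)
    then have "(f ^^ (m - n)) x = z" if "n \<le> m"
      using that funpow_add[of "m - n" n f] by simp
    moreover from 3 have "(f ^^ (n - m)) z = x" if "m \<le> n"
      using that funpow_add[of "n - m" m f] by simp
    ultimately show ?thesis
      using full_orbit_iff[OF assms(1)] by (meson nle_le)
  next
    case (4 n m)
    then have "(f ^^ (n + m)) z = x" by (simp add: funpow_add)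
    then show ?thesis using assms(1) by (auto simp: full_orbit_iff)
  qed
qed

lemma full_orbit_eq: "bij f \<Longrightarrow> y \<in> full_orbit f x \<Longrightarrow> full_orbit f y = full_orbit f x"
  using full_orbit_trans[of f] full_orbit_sym[of f] by blast

text \<open>
  \<open>S\<close>-orbits are equivalence classes, so a family of them with union the \<open>T\<close>-orbit of \<open>x\<close> consists of
  exactly the \<open>S\<close>-orbits of the points of that \<open>T\<close>-orbit.
\<close>

lemma is_orbit_number_unique:
  assumes "bij S" "is_orbit_number T S c" "is_orbit_number T S c'"
  shows "c = c'"
proof -
  fix x
  have det: "\<O> = full_orbit S ` full_orbit T x"
    if O: "\<O> \<subseteq> range (full_orbit S)" "\<Union>\<O> = full_orbit T x" for \<O>
  proof (intro equalityI subsetI)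
    fix Q assume "Q \<in> \<O>"
    then obtain y where y: "Q = full_orbit S y" using O by blast
    then have "y \<in> Q" by (simp add: full_orbit_refl)
    then have "y \<in> full_orbit T x" using O(2) \<open>Q \<in> \<O>\<close> by blast
    then show "Q \<in> full_orbit S ` full_orbit T x" using y by blast
  next
    fix Q assume "Q \<in> full_orbit S ` full_orbit T x"
    then obtain y where y: "y \<in> full_orbit T x" "Q = full_orbit S y" by blast
    then obtain R where R: "R \<in> \<O>" "y \<in> R" using O by blast
    then obtain z where "R = full_orbit S z" using O by blast
    with R y show "Q \<in> \<O>" using full_orbit_eq[OF assms(1)] by metis
  qed
  then show ?thesis
    using assms(2,3) unfolding is_orbit_number_def by metis
qed

text \<open>
  The combinatorics of a speedup on a single orbit. As \<open>T\<close> has no periodic points, each orbit is a copy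
  of the integers, on which \<open>S\<close> jumps forward by at least \<open>1\<close> and at most \<open>P\<close>.
\<close>

locale bounded_speedup =
  fixes T S :: "'a \<Rightarrow> 'a" and p :: "'a \<Rightarrow> nat" and P :: nat
  assumes bij_T: "bij T" and bij_S: "bij S"
    and aperiodic: "(T ^^ n) x = x \<Longrightarrow> n = 0"
    and p_pos: "p x > 0" and p_le: "p x \<le> P"
    and S_eq: "S x = (T ^^ p x) x"
begin

text \<open>
  The points at or before \<open>x\<close> that \<open>S\<close> carries strictly beyond \<open>x\<close>: the jumps over the cut immediately
  after \<open>x\<close>. Each \<open>S\<close>-orbit in the \<open>T\<close>-orbit of \<open>x\<close> passes the cut once, so this set counts the
  \<open>S\<close>-orbits.
\<close>

definition crossing :: "'a \<Rightarrow> 'a set" where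
  "crossing x = {y. \<exists>k. (T ^^ k) y = x \<and> k < p y}"

lemma T_pow_eq_iff: "(T ^^ m) x = (T ^^ n) x \<longleftrightarrow> m = n"
proof -
  have "m = n" if "(T ^^ m) x = (T ^^ n) x" "m \<le> n" for m n
    using funpow_eq_cancel[OF bij_is_inj[OF bij_T] that] aperiodic[of "n - m" x] that by simp
  then show ?thesis by (metis nat_le_linear)
qed

lemma p_eq_iff: "p x = k \<longleftrightarrow> S x = (T ^^ k) x"
  by (simp add: S_eq T_pow_eq_iff)

text \<open>
  A jump over the cut started at most \<open>P - 1\<close> steps earlier. The number of jumps is thus a finite sum of
  indicator functions; in this form it can be integrated.
\<close>

lemma crossing_finite: "finite (crossing x)"
  and crossing_card: "card (crossing x) = (\<Sum>k<P. of_bool (x \<in> (T ^^ k) ` {y. k < p y}))"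
proof -
  let ?K = "{k. \<exists>y. (T ^^ k) y = x \<and> k < p y}"
  let ?g = "\<lambda>k. THE y. (T ^^ k) y = x"
  have g: "?g k = y" if "(T ^^ k) y = x" for k y
    using that inj_fn[OF bij_is_inj[OF bij_T], of k] by (auto simp: inj_eq intro!: the_equality)
  have K: "?K \<subseteq> {..<P}" using p_le by (auto intro: less_le_trans)
  then have "finite ?K" using finite_subset by blast
  moreover have im: "crossing x = ?g ` ?K"
    using g by (force simp: crossing_def)
  ultimately show "finite (crossing x)" by simp
  have "inj_on ?g ?K"
  proof (rule inj_onI)
    fix k l assume "k \<in> ?K" "l \<in> ?K" and kl: "?g k = ?g l"
    then obtain y z where "(T ^^ k) y = x" "(T ^^ l) z = x" by blast
    then have "(T ^^ k) y = (T ^^ l) y" using g kl by metis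
    then show "k = l" by (simp add: T_pow_eq_iff)
  qed
  then have "card (crossing x) = card ?K"
    by (simp add: im card_image)
  also have "?K = {..<P} \<inter> {k. x \<in> (T ^^ k) ` {y. k < p y}}"
    using K by (auto simp: image_iff)
  finally show "card (crossing x) = (\<Sum>k<P. of_bool (x \<in> (T ^^ k) ` {y. k < p y}))"
    by (simp add: sum_of_bool_eq)
qed

text \<open>
  Moving the cut one step forward loses exactly the jump that lands on \<open>T x\<close>, which starts at
  \<open>S\<^sup>-\<^sup>1 (T x)\<close>, and gains exactly the jump that starts at \<open>T x\<close>.
\<close>

lemma crossing_step: "card (crossing (T x)) = card (crossing x)"
proof -
  let ?D = "{y. \<exists>k. (T ^^ k) y = x \<and> Suc k < p y}"
  let ?z = "inv S (T x)"
  have injT: "T u = T v \<longleftrightarrow> u = v" for u v using bij_is_inj[OF bij_T] by (simp add: inj_eq)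
  have z: "S ?z = T x" by (simp add: bij_S bij_is_surj surj_f_inv_f)
  have z': "y = ?z" if "S y = T x" for y using that z bij_is_inj[OF bij_S] by (metis injD)
  obtain k where k: "p ?z = Suc k" using p_pos[of ?z] gr0_implies_Suc by blast
  then have zx: "(T ^^ k) ?z = x" using z injT by (simp add: S_eq)
  have "crossing x = insert ?z ?D"
  proof (intro equalityI subsetI)
    fix y assume "y \<in> crossing x"
    then obtain k where k: "(T ^^ k) y = x" "k < p y" by (auto simp: crossing_def)
    show "y \<in> insert ?z ?D"
    proof (cases "Suc k = p y")
      case True
      then have "S y = T x" using k by (simp add: S_eq flip: True)
      then show ?thesis using z' by blast
    qed (use k in auto)
  next
    fix y assume "y \<in> insert ?z ?D"
    then show "y \<in> crossing x" using zx k by (auto simp: crossing_def)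
  qed
  moreover have "crossing (T x) = insert (T x) ?D"
  proof (intro equalityI subsetI)
    fix y assume "y \<in> crossing (T x)"
    then obtain k where k: "(T ^^ k) y = T x" "k < p y" by (auto simp: crossing_def)
    then show "y \<in> insert (T x) ?D" by (cases k) (auto simp: injT)
  next
    fix y assume "y \<in> insert (T x) ?D"
    then show "y \<in> crossing (T x)"
    proof
      assume "y = T x"
      then show ?thesis using p_pos[of y] unfolding crossing_def by (auto intro!: exI[of _ 0])
    next
      assume "y \<in> ?D"
      then obtain k where "(T ^^ k) y = x" "Suc k < p y" by blast
      then show ?thesis unfolding crossing_def by (auto intro!: exI[of _ "Suc k"])
    qed
  qed
  moreover have "?z \<notin> ?D"
  proof
    assume "?z \<in> ?D"
    then obtain j where j: "(T ^^ j) ?z = x" "Suc j < p ?z" by blast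
    then have "j = k" using zx T_pow_eq_iff by metis
    then show False using j k by simp
  qed
  moreover have "T x \<notin> ?D"
  proof
    assume "T x \<in> ?D"
    then obtain j where "(T ^^ j) (T x) = x" by blast
    then have "(T ^^ Suc j) x = x" by (simp only: funpow_Suc_right comp_apply)
    then show False using aperiodic[of "Suc j" x] by blast
  qed
  moreover have "finite ?D" using calculation(1) crossing_finite[of x] by simp
  ultimately show ?thesis by simp
qed

lemma crossing_self: "x \<in> crossing x"
  using p_pos[of x] by (auto simp: crossing_def intro!: exI[of _ 0])

lemma S_iterate: "\<exists>m\<ge>n. (S ^^ n) x = (T ^^ m) x"
proof (induction n)
  case 0
  show ?case by (intro exI[of _ 0]) simp
next
  case (Suc n)
  then obtain m where m: "m \<ge> n" "(S ^^ n) x = (T ^^ m) x" by blast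
  then have "(S ^^ Suc n) x = (T ^^ (p ((T ^^ m) x) + m)) x" by (simp add: S_eq funpow_add)
  then show ?case using m p_pos[of "(T ^^ m) x"]
    by (intro exI[of _ "p ((T ^^ m) x) + m"]) simp
qed

lemma crossing_meets_S_orbit:
  assumes "z \<in> full_orbit T x"
  shows "\<exists>y\<in>crossing x. z \<in> full_orbit S y"
proof -
  have next_orbit: "S w \<in> full_orbit S w" for w
    unfolding full_orbit_iff[OF bij_S] by (intro disjI1 exI[of _ 1]) simp
  consider m where "(T ^^ m) x = z" | m where "(T ^^ m) z = x"
    using assms full_orbit_iff[OF bij_T] by blast
  then show ?thesis
  proof cases
    \<comment> \<open>Points after \<open>x\<close>: follow \<open>S\<close> backwards until its orbit jumps over \<open>x\<close>.\<close>
    case (1 m)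
    then show ?thesis
    proof (induction m arbitrary: z rule: less_induct)
      case (less m)
      define w where "w = inv S z"
      have w: "S w = z" by (simp add: w_def bij_S bij_is_surj surj_f_inv_f)
      have e: "(T ^^ m) x = (T ^^ p w) w" using less.prems w S_eq by simp
      show ?case
      proof (cases "m = 0")
        case True
        then show ?thesis using less.prems True by (intro bexI[of _ x]) (auto simp: full_orbit_refl crossing_self)
      next
        case False
        have "\<exists>y\<in>crossing x. w \<in> full_orbit S y"
        proof (cases "p w \<le> m")
          case True
          then have "(T ^^ (m - p w)) x = w"
            using funpow_eq_cancel[OF bij_is_inj[OF bij_T] e[symmetric]] by simp
          then show ?thesis using less.IH[of "m - p w" w] False p_pos[of w] by simp
        next
          case pw: False
          then have "(T ^^ (p w - m)) w = x"
            using funpow_eq_cancel[OF bij_is_inj[OF bij_T] e] by simp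
          then have "w \<in> crossing x"
            using pw False by (auto simp: crossing_def intro!: exI[of _ "p w - m"])
          then show ?thesis by (intro bexI[of _ w] full_orbit_refl)
        qed
        then show ?thesis
          using next_orbit[of w] full_orbit_trans[OF bij_S] unfolding w by blast
      qed
    qed
  next
    \<comment> \<open>Points before \<open>x\<close>: follow \<open>S\<close> forwards up to its jump over \<open>x\<close>.\<close>
    case (2 m)
    then show ?thesis
    proof (induction m arbitrary: z rule: less_induct)
      case (less m)
      show ?case
      proof (cases "m < p z")
        case True
        then have "z \<in> crossing x" using less.prems by (auto simp: crossing_def)
        then show ?thesis by (intro bexI[of _ z] full_orbit_refl)
      next
        case False
        then have "(T ^^ (m - p z)) (S z) = x"
          using less.prems funpow_add[of "m - p z" "p z" T] by (simp add: S_eq)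
        then have "\<exists>y\<in>crossing x. S z \<in> full_orbit S y"
          using less.IH[of "m - p z" "S z"] False p_pos[of z] by simp
        then show ?thesis
          using full_orbit_trans[OF bij_S] full_orbit_sym[OF bij_S next_orbit[of z]] by blast
      qed
    qed
  qed
qed

text \<open>
  After its jump over the cut, an \<open>S\<close>-orbit stays beyond it, since \<open>S\<close> only moves forward.
\<close>

lemma crossing_distinct_S_orbits:
  assumes "y \<in> crossing x" "z \<in> crossing x" "z \<in> full_orbit S y"
  shows "y = z"
proof -
  have *: "n = 0" if y: "y \<in> crossing x" and z: "z \<in> crossing x" and n: "(S ^^ n) y = z" for n y z
  proof (rule ccontr)
    assume "n \<noteq> 0"
    then obtain n' where n': "n = Suc n'" using not0_implies_Suc by blast
    obtain k where k: "(T ^^ k) y = x" "k < p y" using y by (auto simp: crossing_def)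
    obtain l where l: "(T ^^ l) z = x" using z by (auto simp: crossing_def)
    have "S y = (T ^^ (p y - k)) x"
      using k funpow_add[of "p y - k" k T] by (simp add: S_eq)
    moreover obtain m where "(S ^^ n') (S y) = (T ^^ m) (S y)" using S_iterate by blast
    ultimately have "z = (T ^^ (m + (p y - k))) x"
      using n n' by (simp add: funpow_add funpow_swap1)
    then have "(T ^^ (l + (m + (p y - k)))) x = x" using l by (simp add: funpow_add)
    then show False using aperiodic[of "l + (m + (p y - k))" x] k by simp
  qed
  consider n where "(S ^^ n) y = z" | n where "(S ^^ n) z = y"
    using assms(3) full_orbit_iff[OF bij_S] by blast
  then show ?thesis
    using *[OF assms(1,2)] *[OF assms(2,1)] by cases force+
qed

lemma S_orbit_subset: "full_orbit S x \<subseteq> full_orbit T x"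
proof
  fix y assume "y \<in> full_orbit S x"
  then show "y \<in> full_orbit T x"
    using S_iterate[of _ x] S_iterate[of _ y]
    unfolding full_orbit_iff[OF bij_T] full_orbit_iff[OF bij_S] by metis
qed

lemma orbit_number_eq:
  assumes "\<And>x. card (crossing x) = c"
  shows "orbit_number T S = c"
proof -
  have "is_orbit_number T S c"
    unfolding is_orbit_number_def
  proof (intro conjI allI)
    show "c > 0"
      using assms[of undefined] crossing_self[of undefined] crossing_finite card_gt_0_iff by blast
    fix x
    have "inj_on (full_orbit S) (crossing x)"
      by (rule inj_onI) (metis crossing_distinct_S_orbits full_orbit_refl)
    then have "card (full_orbit S ` crossing x) = c"
      by (simp add: card_image assms)
    moreover have "\<Union> (full_orbit S ` crossing x) = full_orbit T x"
    proof (intro equalityI subsetI)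
      fix z assume "z \<in> \<Union> (full_orbit S ` crossing x)"
      then obtain y where y: "y \<in> crossing x" "z \<in> full_orbit S y" by blast
      then have "y \<in> full_orbit T x"
        by (auto simp: crossing_def full_orbit_iff[OF bij_T])
      then show "z \<in> full_orbit T x"
        using y S_orbit_subset full_orbit_trans[OF bij_T] by blast
    qed (use crossing_meets_S_orbit in blast)
    ultimately show "\<exists>\<O>. \<O> \<subseteq> range (full_orbit S) \<and> card \<O> = c \<and> \<Union>\<O> = full_orbit T x"
      by (intro exI[of _ "full_orbit S ` crossing x"]) auto
  qed
  then show ?thesis
    unfolding orbit_number_def using is_orbit_number_unique[OF bij_S] by blast
qed

end

section \<open>Entropy of open covers\<close>

lemma min_subcover_le:
  "\<V> \<subseteq> \<U> \<Longrightarrow> finite \<V> \<Longrightarrow> \<Union>\<V> = UNIV \<Longrightarrow> min_subcover \<U> \<le> card \<V>"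
  unfolding min_subcover_def by (rule Least_le) blast

lemma min_subcover_witness:
  assumes "compact (UNIV :: 'a::topological_space set)" "(\<U> :: 'a set set) \<in> open_covers"
  obtains \<V> where "\<V> \<subseteq> \<U>" "finite \<V>" "card \<V> = min_subcover \<U>" "\<Union>\<V> = UNIV"
proof -
  obtain \<V> where "\<V> \<subseteq> \<U>" "finite \<V>" "UNIV \<subseteq> \<Union>\<V>"
    using compactE[OF assms(1), of \<U>] assms(2) by (auto simp: open_covers_def)
  then have "\<exists>k. \<exists>\<V>\<subseteq>\<U>. finite \<V> \<and> card \<V> = k \<and> \<Union>\<V> = UNIV" by blast
  from LeastI_ex[OF this] show thesis
    using that unfolding min_subcover_def by blast
qed

lemma min_subcover_pos:
  assumes "compact (UNIV :: 'a::topological_space set)" "(\<U> :: 'a set set) \<in> open_covers"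
  shows "min_subcover \<U> > 0"
proof -
  obtain \<V> where "\<V> \<subseteq> \<U>" and V: "finite \<V>" "card \<V> = min_subcover \<U>" "\<Union>\<V> = UNIV"
    using min_subcover_witness[OF assms] .
  then have "\<V> \<noteq> {}" by auto
  then show ?thesis using V by (simp add: card_gt_0_iff flip: V(2))
qed

text \<open>
  Enlarging each member of a subcover of \<open>\<V>\<close> to a member of \<open>\<U>\<close> gives a subcover of \<open>\<U>\<close> of no larger
  cardinality.
\<close>

lemma min_subcover_refinement:
  assumes "compact (UNIV :: 'a::topological_space set)" "(\<V> :: 'a set set) \<in> open_covers"
    and "\<And>V. V \<in> \<V> \<Longrightarrow> \<exists>U\<in>\<U>. V \<subseteq> U"
  shows "min_subcover \<U> \<le> min_subcover \<V>"
proof -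
  obtain \<W> where W: "\<W> \<subseteq> \<V>" "finite \<W>" "card \<W> = min_subcover \<V>" "\<Union>\<W> = UNIV"
    using min_subcover_witness[OF assms(1,2)] .
  obtain f where f: "\<And>V. V \<in> \<V> \<Longrightarrow> f V \<in> \<U> \<and> V \<subseteq> f V" using assms(3) by metis
  have "min_subcover \<U> \<le> card (f ` \<W>)"
  proof (rule min_subcover_le)
    show "f ` \<W> \<subseteq> \<U>" "finite (f ` \<W>)" using f W by auto
    have "\<Union>\<W> \<subseteq> \<Union>(f ` \<W>)" using f W(1) by fastforce
    then show "\<Union>(f ` \<W>) = UNIV" using W(4) by auto
  qed
  then show ?thesis using card_image_le[OF W(2), of f] W(3) by simp
qed

lemma iterated_join_open_covers:
  fixes T :: "'a::topological_space \<Rightarrow> 'a"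
  assumes "continuous_on UNIV T" "\<U> \<in> open_covers"
  shows "iterated_join T \<U> n \<in> open_covers"
proof -
  have "open V" if V: "V \<in> iterated_join T \<U> n" for V
  proof -
    obtain A where A: "V = (\<Inter>i<n. (T ^^ i) -` A i)" "\<forall>i<n. A i \<in> \<U>"
      using V by (auto simp: iterated_join_def)
    then have "open ((T ^^ i) -` A i)" if "i < n" for i
      using that assms(2) continuous_funpow[OF assms(1), of i]
      by (intro open_vimage) (auto simp: open_covers_def)
    then show ?thesis unfolding A(1) by (intro open_INT) auto
  qed
  moreover have "\<exists>V\<in>iterated_join T \<U> n. x \<in> V" for x
  proof -
    have "\<forall>i. \<exists>U\<in>\<U>. (T ^^ i) x \<in> U" using assms(2) by (auto simp: open_covers_def)
    then obtain A where "\<And>i. A i \<in> \<U>" "\<And>i. (T ^^ i) x \<in> A i" by metis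
    then show ?thesis
      by (intro bexI[of _ "\<Inter>i<n. (T ^^ i) -` A i"]) (auto simp: iterated_join_def)
  qed
  ultimately show ?thesis by (auto simp: open_covers_def)
qed

lemma all_less_add: "(\<forall>i<m + n. Q i) \<longleftrightarrow> (\<forall>i<m. Q i) \<and> (\<forall>i<n. Q (m + i))" for m n :: nat
proof (intro iffI conjI allI impI)
  fix i assume "(\<forall>i<m. Q i) \<and> (\<forall>i<n. Q (m + i))" "i < m + n"
  then show "Q i" by (cases "i < m") (auto dest: spec[of _ "i - m"])
qed auto

lemma min_subcover_iterated_join_add:
  fixes T :: "'a::topological_space \<Rightarrow> 'a"
  assumes "compact (UNIV :: 'a set)" "continuous_on UNIV T" "\<U> \<in> open_covers"
  shows "min_subcover (iterated_join T \<U> (m + n))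
    \<le> min_subcover (iterated_join T \<U> m) * min_subcover (iterated_join T \<U> n)"
proof -
  note J = iterated_join_open_covers[OF assms(2,3)]
  obtain \<V> where V: "\<V> \<subseteq> iterated_join T \<U> m" "finite \<V>"
    "card \<V> = min_subcover (iterated_join T \<U> m)" "\<Union>\<V> = UNIV"
    using min_subcover_witness[OF assms(1) J] .
  obtain \<W> where W: "\<W> \<subseteq> iterated_join T \<U> n" "finite \<W>"
    "card \<W> = min_subcover (iterated_join T \<U> n)" "\<Union>\<W> = UNIV"
    using min_subcover_witness[OF assms(1) J] .
  let ?f = "\<lambda>(V, W). V \<inter> (T ^^ m) -` W"
  have "min_subcover (iterated_join T \<U> (m + n)) \<le> card (?f ` (\<V> \<times> \<W>))"
  proof (rule min_subcover_le)
    have "V \<inter> (T ^^ m) -` W \<in> iterated_join T \<U> (m + n)"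
      if VW: "V \<in> iterated_join T \<U> m" "W \<in> iterated_join T \<U> n" for V W
    proof -
      obtain A B where A: "V = (\<Inter>i<m. (T ^^ i) -` A i)" "\<forall>i<m. A i \<in> \<U>"
        and B: "W = (\<Inter>i<n. (T ^^ i) -` B i)" "\<forall>i<n. B i \<in> \<U>"
        using VW by (auto simp: iterated_join_def)
      define C where "C i = (if i < m then A i else B (i - m))" for i
      have "(T ^^ i) ((T ^^ m) x) = (T ^^ (m + i)) x" for i x
        by (simp add: add.commute[of m] funpow_add)
      then have "x \<in> V \<inter> (T ^^ m) -` W \<longleftrightarrow>
          (\<forall>i<m. (T ^^ i) x \<in> A i) \<and> (\<forall>i<n. (T ^^ (m + i)) x \<in> B i)" for x
        by (auto simp: A B)
      moreover have "x \<in> (\<Inter>i<m + n. (T ^^ i) -` C i) \<longleftrightarrow>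
          (\<forall>i<m. (T ^^ i) x \<in> A i) \<and> (\<forall>i<n. (T ^^ (m + i)) x \<in> B i)" for x
      proof -
        have "(\<forall>i<m + n. (T ^^ i) x \<in> C i) \<longleftrightarrow>
          (\<forall>i<m. (T ^^ i) x \<in> C i) \<and> (\<forall>i<n. (T ^^ (m + i)) x \<in> C (m + i))"
          by (rule all_less_add)
        moreover have "x \<in> (\<Inter>i<m + n. (T ^^ i) -` C i) \<longleftrightarrow> (\<forall>i<m + n. (T ^^ i) x \<in> C i)"
          by auto
        ultimately show ?thesis by (simp add: C_def)
      qed
      ultimately have "V \<inter> (T ^^ m) -` W = (\<Inter>i<m + n. (T ^^ i) -` C i)"
        by (intro set_eqI) (simp only:)
      moreover have "\<forall>i<m + n. C i \<in> \<U>" using A B by (auto simp: C_def)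
      ultimately show ?thesis unfolding iterated_join_def by blast
    qed
    then show "?f ` (\<V> \<times> \<W>) \<subseteq> iterated_join T \<U> (m + n)" using V(1) W(1) by auto
    show "finite (?f ` (\<V> \<times> \<W>))" using V(2) W(2) by simp
    have "x \<in> \<Union> (?f ` (\<V> \<times> \<W>))" for x
    proof -
      obtain V where "V \<in> \<V>" "x \<in> V" using V(4) by blast
      moreover obtain W where "W \<in> \<W>" "(T ^^ m) x \<in> W" using W(4) by blast
      ultimately show ?thesis by force
    qed
    then show "\<Union> (?f ` (\<V> \<times> \<W>)) = UNIV" by blast
  qed
  also have "\<dots> \<le> card (\<V> \<times> \<W>)" using V(2) W(2) by (intro card_image_le) simp
  finally show ?thesis by (simp add: card_cartesian_product V(3) W(3))
qed

text \<open>
  Fekete's lemma; the limit is the infimum. Division with remainder by a fixed \<open>k\<close> gives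
  \<open>a n \<le> (n div k) * a k + a (n mod k)\<close>, whose last term is bounded.
\<close>

lemma subadditive_convergent:
  fixes a :: "nat \<Rightarrow> real"
  assumes nonneg: "\<And>n. 0 \<le> a n" and sub: "\<And>m n. a (m + n) \<le> a m + a n"
  shows "convergent (\<lambda>n. a n / real n)"
proof -
  define L where "L = (INF n\<in>{1..}. a n / real n)"
  have bdd: "bdd_below ((\<lambda>n. a n / real n) ` {1..})"
    by (rule bdd_belowI[of _ 0]) (auto simp: nonneg)
  have mult: "a (q * k + r) \<le> real q * a k + a r" for q k r
  proof (induction q)
    case (Suc q)
    have "a (Suc q * k + r) \<le> a k + a (q * k + r)" using sub[of k "q * k + r"] by (simp add: add.assoc)
    with Suc show ?case by (simp add: algebra_simps)
  qed simp
  have "(\<lambda>n. a n / real n) \<longlonglongrightarrow> L"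
  proof (rule order_tendstoI)
    fix l assume "l < L"
    moreover have "L \<le> a n / real n" if "n \<ge> 1" for n
      unfolding L_def by (rule cINF_lower[OF bdd]) (use that in simp)
    ultimately show "\<forall>\<^sub>F n in sequentially. l < a n / real n"
      by (intro eventually_sequentiallyI[of 1]) (meson less_le_trans)
  next
    fix u assume "L < u"
    then obtain k where k: "k \<ge> 1" "a k / real k < u"
      using cINF_less_iff[OF _ bdd, of u] by (auto simp: L_def)
    define M where "M = (\<Sum>r<k. a r)"
    have bound: "a n / real n \<le> a k / real k + M / real n" if n: "n \<ge> 1" for n
    proof -
      have "a (n mod k) \<le> M"
        unfolding M_def using k(1) by (intro member_le_sum) (auto simp: nonneg)
      moreover have "real (n div k) * a k \<le> real n / real k * a k"
        using of_nat_div_le_of_nat[of n k, where ?'a = real] by (intro mult_right_mono nonneg)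
      moreover have "a n \<le> real (n div k) * a k + a (n mod k)"
        using mult[of "n div k" k "n mod k"] by simp
      ultimately have "a n \<le> real n / real k * a k + M" by linarith
      then have "a n / real n \<le> (real n / real k * a k + M) / real n" by (rule divide_right_mono) simp
      also have "\<dots> = a k / real k + M / real n" using n by (simp add: field_simps)
      finally show ?thesis .
    qed
    have "(\<lambda>n. a k / real k + M / real n) \<longlonglongrightarrow> a k / real k + 0"
      by (intro tendsto_intros lim_const_over_n)
    then have "\<forall>\<^sub>F n in sequentially. a k / real k + M / real n < u"
      using k(2) by (intro order_tendstoD(2)) auto
    then show "\<forall>\<^sub>F n in sequentially. a n / real n < u"
      using eventually_ge_at_top[of 1] by eventually_elim (use bound in force)
  qed
  then show ?thesis by (rule convergentI)
qed

text \<open>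
  Covers of orbit segments of lengths \<open>m\<close> and \<open>n\<close> combine to covers of segments of length \<open>m + n\<close>, so
  the logarithms are subadditive and the \<open>lim\<close> defining the entropy is a genuine, finite limit.
\<close>

lemma cover_entropy_limit:
  fixes T :: "'a::topological_space \<Rightarrow> 'a"
  assumes "compact (UNIV :: 'a set)" "continuous_on UNIV T" "\<U> \<in> open_covers"
  obtains h where "cover_entropy T \<U> = ereal h"
    "(\<lambda>n. ln (real (min_subcover (iterated_join T \<U> n))) / real n) \<longlonglongrightarrow> h"
proof -
  let ?N = "\<lambda>n. min_subcover (iterated_join T \<U> n)"
  have pos: "?N n > 0" for n
    by (rule min_subcover_pos[OF assms(1) iterated_join_open_covers[OF assms(2,3)]])
  have "convergent (\<lambda>n. ln (real (?N n)) / real n)"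
  proof (rule subadditive_convergent)
    show "0 \<le> ln (real (?N n))" for n using pos[of n] by simp
    show "ln (real (?N (m + n))) \<le> ln (real (?N m)) + ln (real (?N n))" for m n
    proof -
      have "ln (real (?N (m + n))) \<le> ln (real (?N m) * real (?N n))"
        using min_subcover_iterated_join_add[OF assms, of m n] pos[of "m + n"] pos[of m] pos[of n]
        by (subst ln_le_cancel_iff) (simp_all flip: of_nat_mult)
      then show ?thesis using pos[of m] pos[of n] by (simp add: ln_mult)
    qed
  qed
  then obtain h where h: "(\<lambda>n. ln (real (?N n)) / real n) \<longlonglongrightarrow> h" by (auto simp: convergent_def)
  then have "cover_entropy T \<U> = ereal h"
    unfolding cover_entropy_def by (intro limI) (simp add: tendsto_ereal)
  with h show thesis by (rule that[rotated])
qed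

text \<open>
  If \<open>n\<close> steps of \<open>S\<close> are worth \<open>m n\<close> steps of \<open>T\<close>, where \<open>m n\<close> is asymptotic to \<open>c * n\<close>, then entropies
  compare with the factor \<open>c\<close>, because \<open>ln N\<^sub>k / n = (k / n) * (ln N\<^sub>k / k)\<close> for \<open>k = m n\<close>, where \<open>N\<^sub>k\<close> is the cardinality of
  a minimal subcover of the \<open>k\<close>-fold join.
\<close>

lemma cover_entropy_time_change:
  fixes T S :: "'a::topological_space \<Rightarrow> 'a" and m :: "nat \<Rightarrow> nat"
  assumes "compact (UNIV :: 'a set)" "continuous_on UNIV T" "continuous_on UNIV S"
    and "\<U> \<in> open_covers" "\<V> \<in> open_covers"
    and m: "filterlim m at_top sequentially" "(\<lambda>n. real (m n) / real n) \<longlonglongrightarrow> c"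
  shows cover_entropy_time_change_le:
    "(\<And>n. min_subcover (iterated_join T \<U> (m n)) \<le> min_subcover (iterated_join S \<V> n)) \<Longrightarrow>
      ereal c * cover_entropy T \<U> \<le> cover_entropy S \<V>"
    and cover_entropy_time_change_ge:
    "(\<And>n. min_subcover (iterated_join S \<V> n) \<le> min_subcover (iterated_join T \<U> (m n))) \<Longrightarrow>
      cover_entropy S \<V> \<le> ereal c * cover_entropy T \<U>"
proof -
  let ?a = "\<lambda>n. ln (real (min_subcover (iterated_join T \<U> n)))"
  let ?b = "\<lambda>n. ln (real (min_subcover (iterated_join S \<V> n)))"
  obtain h where h: "cover_entropy T \<U> = ereal h" "(\<lambda>n. ?a n / real n) \<longlonglongrightarrow> h"
    using cover_entropy_limit[OF assms(1,2,4)] .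
  obtain g where g: "cover_entropy S \<V> = ereal g" "(\<lambda>n. ?b n / real n) \<longlonglongrightarrow> g"
    using cover_entropy_limit[OF assms(1,3,5)] .
  have pos: "min_subcover (iterated_join T \<U> n) > 0" "min_subcover (iterated_join S \<V> n) > 0" for n
    by (intro min_subcover_pos iterated_join_open_covers assms)+
  have "(\<lambda>n. (real (m n) / real n) * (?a (m n) / real (m n))) \<longlonglongrightarrow> c * h"
    by (intro tendsto_mult m(2) filterlim_compose[OF h(2) m(1)])
  moreover have "\<forall>\<^sub>F n in sequentially. m n \<ge> 1"
    using m(1) by (simp add: filterlim_at_top)
  then have "\<forall>\<^sub>F n in sequentially. (real (m n) / real n) * (?a (m n) / real (m n)) = ?a (m n) / real n"
    by eventually_elim simp
  ultimately have am: "(\<lambda>n. ?a (m n) / real n) \<longlonglongrightarrow> c * h"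
    by (rule Lim_transform_eventually)
  show "ereal c * cover_entropy T \<U> \<le> cover_entropy S \<V>"
    if le: "\<And>n. min_subcover (iterated_join T \<U> (m n)) \<le> min_subcover (iterated_join S \<V> n)"
  proof -
    have "?a (m n) / real n \<le> ?b n / real n" for n
      using le[of n] pos[of "m n"] pos[of n] by (intro divide_right_mono) simp_all
    then have "c * h \<le> g" by (intro LIMSEQ_le[OF am g(2)]) blast
    then show ?thesis by (simp add: h g)
  qed
  show "cover_entropy S \<V> \<le> ereal c * cover_entropy T \<U>"
    if le: "\<And>n. min_subcover (iterated_join S \<V> n) \<le> min_subcover (iterated_join T \<U> (m n))"
  proof -
    have "?b n / real n \<le> ?a (m n) / real n" for n
      using le[of n] pos[of "m n"] pos[of n] by (intro divide_right_mono) simp_all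
    then have "g \<le> c * h" by (intro LIMSEQ_le[OF g(2) am]) blast
    then show ?thesis by (simp add: h g)
  qed
qed

section \<open>Itineraries under a time change\<close>

text \<open>
  The join of the cover with the partition into level sets of \<open>p\<close>. An itinerary with respect to it
  records the jump lengths, and so determines how the times of \<open>S\<close> and \<open>T\<close> correspond.
\<close>

definition label_refinement :: "('a \<Rightarrow> nat) \<Rightarrow> 'a set set \<Rightarrow> 'a set set" where
  "label_refinement p \<U> = {U \<inter> p -` {k} | U k. U \<in> \<U>}"

lemma label_refinementE:
  assumes "A \<in> label_refinement p \<U>"
  obtains U where "U \<in> \<U>" "A \<subseteq> U" "\<And>x y. x \<in> A \<Longrightarrow> y \<in> A \<Longrightarrow> p x = p y"
proof -
  obtain U k where "U \<in> \<U>" "A = U \<inter> p -` {k}"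
    using assms by (auto simp: label_refinement_def)
  then show thesis by (intro that[of U]) auto
qed

lemma label_refinement_open_covers:
  assumes "\<U> \<in> open_covers" "\<And>k. open (p -` {k})"
  shows "label_refinement p \<U> \<in> open_covers"
proof -
  have "\<exists>A\<in>label_refinement p \<U>. x \<in> A" for x
  proof -
    obtain U where "U \<in> \<U>" "x \<in> U" using assms(1) unfolding open_covers_def by blast
    then show ?thesis
      by (intro bexI[of _ "U \<inter> p -` {p x}"]) (auto simp: label_refinement_def)
  qed
  then show ?thesis
    using assms by (auto simp: open_covers_def label_refinement_def)
qed

context bounded_speedup
begin

text \<open>
  The cocycle generated by \<open>p\<close> over \<open>S\<close>: time is measured in steps of \<open>T\<close>.
\<close>

definition time :: "nat \<Rightarrow> 'a \<Rightarrow> nat" where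
  "time n x = (\<Sum>i<n. p ((S ^^ i) x))"

lemma time_0: "time 0 x = 0" and time_Suc: "time (Suc n) x = time n x + p ((S ^^ n) x)"
  by (simp_all add: time_def)

lemma S_pow_eq: "(S ^^ n) x = (T ^^ time n x) x"
proof (induction n)
  case (Suc n)
  have "(S ^^ Suc n) x = (T ^^ p ((S ^^ n) x)) ((T ^^ time n x) x)"
    by (simp add: S_eq[of "(S ^^ n) x"] flip: Suc)
  then show ?case by (simp add: time_Suc funpow_add add.commute[of "time n x"])
qed (simp add: time_0)

lemma time_strict_mono: "i < j \<Longrightarrow> time i x < time j x"
  by (rule lift_Suc_mono_less[of "\<lambda>n. time n x"]) (simp_all add: time_Suc p_pos)

lemma le_time: "n \<le> time n x"
proof (induction n)
  case (Suc n)
  then show ?case using p_pos[of "(S ^^ n) x"] by (simp add: time_Suc)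
qed simp

lemma time_le: "time n x \<le> n * P"
  using sum_bounded_above[of "{..<n}" "\<lambda>i. p ((S ^^ i) x)" P] p_le by (simp add: time_def)

text \<open>
  A \<open>T\<close>-itinerary long enough to cover \<open>n\<close> steps of \<open>S\<close> shows the value of \<open>p\<close> at each time, in
  particular at the times when the \<open>S\<close>-orbit is visited. Step by step it therefore fixes those times,
  and the members of \<open>\<U>\<close> seen then form an \<open>S\<close>-itinerary.
\<close>

lemma T_join_refines_S_join:
  assumes V: "V \<in> iterated_join T (label_refinement p \<U>) M" and M: "\<And>x. time n x \<le> M"
    and ne: "\<U> \<noteq> {}"
  shows "\<exists>W\<in>iterated_join S \<U> n. V \<subseteq> W"
proof (cases "V = {}")
  case True
  then show ?thesis using ne by (auto simp: iterated_join_def)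
next
  case False
  then obtain x where x: "x \<in> V" by blast
  obtain A where A: "V = (\<Inter>i<M. (T ^^ i) -` A i)" "\<forall>i<M. A i \<in> label_refinement p \<U>"
    using V by (auto simp: iterated_join_def)
  have lt: "time j x < M" if "j < n" for j
    using time_strict_mono[OF that, of x] M[of x] by simp
  \<comment> \<open>Equal times up to \<open>j\<close> put both points into the same set \<open>A (time j x)\<close>, on which \<open>p\<close> is constant.\<close>
  have *: "time j y = time j x" if "y \<in> V" "j \<le> n" for y j
    using that(2)
  proof (induction j)
    case (Suc j)
    then have "(S ^^ j) y \<in> A (time j x)" "(S ^^ j) x \<in> A (time j x)"
      using lt[of j] x \<open>y \<in> V\<close> by (auto simp: S_pow_eq A(1))
    moreover have "A (time j x) \<in> label_refinement p \<U>" using A(2) lt[of j] Suc.prems by simp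
    ultimately have "p ((S ^^ j) y) = p ((S ^^ j) x)" by (metis label_refinementE)
    with Suc show ?case by (simp add: time_Suc)
  qed (simp add: time_0)
  have "\<forall>j<n. \<exists>U\<in>\<U>. A (time j x) \<subseteq> U"
    using A(2) lt by (metis label_refinementE)
  then obtain U where U: "\<And>j. j < n \<Longrightarrow> U j \<in> \<U> \<and> A (time j x) \<subseteq> U j" by metis
  have "V \<subseteq> (\<Inter>j<n. (S ^^ j) -` U j)"
  proof (intro INT_greatest subsetI)
    fix y j assume "y \<in> V" "j \<in> {..<n}"
    then have "(S ^^ j) y \<in> A (time j x)" using lt[of j] *[of y j] by (simp add: S_pow_eq A(1))
    then show "y \<in> (S ^^ j) -` U j" using U[of j] \<open>j \<in> {..<n}\<close> by auto
  qed
  moreover have "(\<Inter>j<n. (S ^^ j) -` U j) \<in> iterated_join S \<U> n"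
    using U by (auto simp: iterated_join_def)
  ultimately show ?thesis by blast
qed

text \<open>
  Conversely, an \<open>S\<close>-itinerary which at each step also records the next \<open>P\<close> steps under \<open>T\<close> leaves no
  gaps: consecutive points of an \<open>S\<close>-orbit are at most \<open>P\<close> steps apart.
\<close>

lemma S_join_refines_T_join:
  assumes V: "V \<in> iterated_join S (label_refinement p (iterated_join T \<U> P)) n"
    and m: "\<And>x. m \<le> time n x" and ne: "\<U> \<noteq> {}"
  shows "\<exists>W\<in>iterated_join T \<U> m. V \<subseteq> W"
proof (cases "V = {}")
  case True
  then show ?thesis using ne by (auto simp: iterated_join_def)
next
  case False
  then obtain x where x: "x \<in> V" by blast
  obtain A where A: "V = (\<Inter>j<n. (S ^^ j) -` A j)"
    "\<forall>j<n. A j \<in> label_refinement p (iterated_join T \<U> P)"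
    using V by (auto simp: iterated_join_def)
  have *: "time j y = time j x" if "y \<in> V" "j \<le> n" for y j
    using that(2)
  proof (induction j)
    case (Suc j)
    then have "(S ^^ j) y \<in> A j" "(S ^^ j) x \<in> A j"
      using x \<open>y \<in> V\<close> by (auto simp: A(1))
    moreover have "A j \<in> label_refinement p (iterated_join T \<U> P)" using A(2) Suc.prems by simp
    ultimately have "p ((S ^^ j) y) = p ((S ^^ j) x)" by (metis label_refinementE)
    with Suc show ?case by (simp add: time_Suc)
  qed (simp add: time_0)
  have "\<exists>U\<in>\<U>. \<forall>y\<in>V. (T ^^ i) y \<in> U" if i: "i < m" for i
  proof -
    \<comment> \<open>Time \<open>i\<close> falls into some step of \<open>S\<close>, which lasts for at most \<open>P\<close> units of time.\<close>
    have "i < time N x \<Longrightarrow> \<exists>j<N. time j x \<le> i \<and> i < time (Suc j) x" for N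
    proof (induction N)
      case (Suc N)
      then show ?case by (cases "i < time N x") (auto simp: not_less intro: less_SucI)
    qed (simp add: time_0)
    moreover have "i < time n x" using i m[of x] by simp
    ultimately obtain j where j: "j < n" "time j x \<le> i" "i < time (Suc j) x" by blast
    define l where "l = i - time j x"
    have l: "l < P" "i = l + time j x"
      using j p_le[of "(S ^^ j) x"] by (auto simp: l_def time_Suc)
    obtain W where W: "W \<in> iterated_join T \<U> P" "A j \<subseteq> W"
      using A(2) j(1) by (metis label_refinementE)
    then obtain B where B: "W = (\<Inter>i<P. (T ^^ i) -` B i)" "\<forall>i<P. B i \<in> \<U>"
      by (auto simp: iterated_join_def)
    have "(T ^^ i) y \<in> B l" if y: "y \<in> V" for y
    proof -
      have "(S ^^ j) y \<in> W" using y j(1) W(2) by (auto simp: A(1))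
      then have "(T ^^ l) ((S ^^ j) y) \<in> B l" using l(1) by (auto simp: B(1))
      moreover have "(T ^^ i) y = (T ^^ l) ((S ^^ j) y)"
        using *[OF y, of j] j(1) by (simp add: l(2) S_pow_eq funpow_add)
      ultimately show ?thesis by simp
    qed
    then show ?thesis using B(2) l(1) by blast
  qed
  then obtain U where U: "\<And>i. i < m \<Longrightarrow> U i \<in> \<U> \<and> (\<forall>y\<in>V. (T ^^ i) y \<in> U i)" by metis
  have "V \<subseteq> (\<Inter>i<m. (T ^^ i) -` U i)" using U by auto
  moreover have "(\<Inter>i<m. (T ^^ i) -` U i) \<in> iterated_join T \<U> m"
    using U by (auto simp: iterated_join_def)
  ultimately show ?thesis by blast
qed

end

section \<open>Invariant measures and uniform averages\<close>

text \<open>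
  Finitely additive is enough: by compactness a decreasing sequence of clopen sets with empty
  intersection is eventually empty, so the Caratheodory extension theorem applies to the algebra of
  clopen sets.
\<close>

lemma clopen_content_extends:
  fixes f :: "'a::topological_space set \<Rightarrow> real"
  assumes cantor: "cantor_space TYPE('a)"
    and nonneg: "\<And>A. 0 \<le> f A" and empty: "f {} = 0" and total: "f UNIV = 1"
    and add: "\<And>A B. A \<inter> B = {} \<Longrightarrow> f (A \<union> B) = f A + f B"
  obtains \<mu> where "prob_space \<mu>" "sets \<mu> = sets borel" "\<And>A. clopen A \<Longrightarrow> measure \<mu> A = f A"
proof -
  interpret C: ring_of_sets UNIV "Collect clopen :: 'a set set"
    by (rule ring_of_setsI) (auto simp: clopen_empty clopen_Un clopen_Diff)
  have "\<exists>\<nu>. (\<forall>A\<in>Collect clopen. \<nu> A = ennreal (f A)) \<and>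
    measure_space UNIV (sigma_sets UNIV (Collect clopen)) \<nu>"
  proof (rule C.caratheodory_empty_continuous)
    show "positive (Collect clopen) (\<lambda>A. ennreal (f A))" by (simp add: positive_def empty)
    show "additive (Collect clopen) (\<lambda>A. ennreal (f A))"
      by (auto simp: additive_def add nonneg)
    fix A :: "nat \<Rightarrow> 'a set"
    assume A: "range A \<subseteq> Collect clopen" "decseq A" "(\<Inter>i. A i) = {}"
    have "\<exists>N. A N = {}"
    proof -
      have "clopen (A i)" for i using A(1) by blast
      then have "open (- A i)" for i by (simp add: clopen_def open_Compl)
      then obtain D where D: "finite D" "UNIV \<subseteq> (\<Union>i\<in>D. - A i)"
        by (rule compactE_image[OF cantor_space_compact[OF cantor], of UNIV "\<lambda>i. - A i"])
           (use A(3) in auto)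
      have "A (Max D) \<subseteq> A i" if "i \<in> D" for i
        using A(2) D(1) that by (simp add: decseq_def)
      then have "A (Max D) = {}" using D(2) by fast
      then show ?thesis ..
    qed
    then obtain N where N: "A N = {}" ..
    have "ennreal (f (A n)) = 0" if "n \<ge> N" for n
    proof -
      have "A n = {}" using decseqD[OF A(2) that] N by blast
      then show ?thesis by (simp add: empty)
    qed
    then show "(\<lambda>i. ennreal (f (A i))) \<longlonglongrightarrow> 0"
      by (intro tendsto_eventually eventually_sequentiallyI[of N])
  qed simp
  then obtain \<nu> where \<nu>: "\<And>A. clopen A \<Longrightarrow> \<nu> A = ennreal (f A)"
    "measure_space UNIV (sigma_sets UNIV (Collect clopen)) \<nu>" by auto
  define \<mu> where "\<mu> = measure_of UNIV (sigma_sets UNIV (Collect clopen)) \<nu>"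
  have sets: "sets \<mu> = sigma_sets UNIV (Collect clopen)"
    by (simp add: \<mu>_def sigma_sets_sigma_sets_eq)
  have em: "emeasure \<mu> A = ennreal (f A)" if "clopen A" for A
  proof -
    have "emeasure \<mu> A = \<nu> A"
      unfolding \<mu>_def using \<nu>(2) that
      by (intro emeasure_measure_of_sigma) (auto simp: measure_space_def)
    with \<nu>(1)[OF that] show ?thesis by simp
  qed
  have "space \<mu> = UNIV" by (simp add: \<mu>_def space_measure_of_conv)
  show thesis
  proof
    show "prob_space \<mu>"
      by (rule prob_spaceI) (simp add: \<open>space \<mu> = UNIV\<close> em clopen_UNIV total)
    show "sets \<mu> = sets borel" by (simp add: sets cantor_space_borel_eq[OF cantor])
    show "measure \<mu> A = f A" if "clopen A" for A
      by (simp add: measure_def em[OF that] nonneg)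
  qed
qed

lemma invariant_measures_clopenI:
  fixes S :: "'a::topological_space \<Rightarrow> 'a"
  assumes cantor: "cantor_space TYPE('a)" and S: "continuous_on UNIV S"
    and \<mu>: "prob_space \<mu>" "sets \<mu> = sets borel"
    and inv: "\<And>A. clopen A \<Longrightarrow> measure \<mu> (S -` A) = measure \<mu> A"
  shows "\<mu> \<in> invariant_measures S"
proof -
  interpret prob_space \<mu> by fact
  have sp: "space \<mu> = UNIV" using sets_eq_imp_space_eq[OF \<mu>(2)] by simp
  have Sm: "S \<in> measurable \<mu> borel"
    using borel_measurable_continuous_onI[OF S] measurable_cong_sets[OF \<mu>(2) refl] by blast
  have "distr \<mu> borel S = \<mu>"
  proof (rule measure_eqI_generator_eq[where E = "Collect clopen" and \<Omega> = UNIV and A = "\<lambda>_. UNIV"])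
    show "Int_stable (Collect clopen :: 'a set set)" by (auto simp: Int_stable_def clopen_Int)
    show "emeasure (distr \<mu> borel S) X = emeasure \<mu> X" if "X \<in> Collect clopen" for X
    proof -
      have "X \<in> sets borel" using that by (simp add: clopen_def)
      then show ?thesis
        using inv[of X] that by (simp add: emeasure_distr[OF Sm] sp emeasure_eq_measure)
    qed
    show "emeasure (distr \<mu> borel S) UNIV \<noteq> \<infinity>"
      by (simp add: emeasure_distr[OF Sm] emeasure_eq_measure)
  qed (auto simp: \<mu>(2) cantor_space_borel_eq[OF cantor] clopen_UNIV)
  then have "emeasure \<mu> (S -` A) = emeasure \<mu> A" if "A \<in> sets borel" for A
    using emeasure_distr[OF Sm that] by (simp add: sp)
  then show ?thesis using \<mu> by (simp add: invariant_measures_def)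
qed

definition visit_frequency :: "('a \<Rightarrow> 'a) \<Rightarrow> nat \<Rightarrow> 'a \<Rightarrow> 'a set \<Rightarrow> real" where
  "visit_frequency S n x A = (\<Sum>i<n. indicator A ((S ^^ i) x)) / real n"

lemma visit_frequency_bounds: "0 \<le> visit_frequency S n x A" "visit_frequency S n x A \<le> 1"
proof -
  have "(\<Sum>i<n. indicator A ((S ^^ i) x)) \<le> (\<Sum>i<n. 1 :: real)"
    by (intro sum_mono) (simp add: indicator_def)
  then show "visit_frequency S n x A \<le> 1" by (simp add: visit_frequency_def divide_le_eq)
  show "0 \<le> visit_frequency S n x A"
    by (simp add: visit_frequency_def sum_nonneg)
qed

lemma visit_frequency_invariance:
  "\<bar>visit_frequency S n x (S -` A) - visit_frequency S n x A\<bar> \<le> 1 / real n"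
proof -
  let ?f = "\<lambda>i. indicator A ((S ^^ i) x) :: real"
  have "(\<Sum>i<n. ?f (Suc i)) - (\<Sum>i<n. ?f i) = ?f n - ?f 0"
    using sum_lessThan_telescope[of ?f n] by (simp add: sum_subtractf)
  moreover have "\<bar>?f n - ?f 0\<bar> \<le> 1" by (simp add: indicator_def)
  moreover have "indicator (S -` A) ((S ^^ i) x) = ?f (Suc i)" for i
    by (simp add: indicator_def)
  ultimately show ?thesis
    by (simp add: visit_frequency_def divide_right_mono flip: diff_divide_distrib)
qed

text \<open>
  Compactness of the product \<open>[0, 1]\<^sup>I\<close>, phrased with a filter \<open>H\<close> in place of a subsequence: for an
  uncountable index type the cube need not be sequentially compact, and all that limits of
  frequencies have to satisfy passes through an arbitrary filter.
\<close>

lemma cluster_point_in_unit_cube: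
  fixes g :: "nat \<Rightarrow> 'b \<Rightarrow> real"
  assumes "\<And>j A. g j A \<in> {0..1}"
  obtains H f where "H \<noteq> bot" "H \<le> sequentially" "\<And>A. ((\<lambda>j. g j A) \<longlongrightarrow> f A) H"
proof -
  let ?K = "PiE UNIV (\<lambda>_ :: 'b. {0..1 :: real})"
  have "compact ?K"
    using compactin_PiE[of "\<lambda>_ :: 'b. euclidean :: real topology" UNIV "\<lambda>_. {0..1}"]
    by (simp add: euclidean_product_topology)
  moreover have "filtermap g sequentially \<noteq> bot" by (simp add: filtermap_bot_iff)
  moreover have "eventually (\<lambda>h. h \<in> ?K) (filtermap g sequentially)"
    using assms by (simp add: eventually_filtermap PiE_def Pi_def)
  ultimately obtain f where f: "inf (nhds f) (filtermap g sequentially) \<noteq> bot"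
    unfolding compact_filter by blast
  define H where "H = inf (filtercomap g (nhds f)) sequentially"
  \<comment> \<open>If \<open>H\<close> were trivial, some neighbourhood of \<open>f\<close> would eventually be avoided by \<open>g\<close>.\<close>
  have "H \<noteq> bot"
  proof
    assume "H = bot"
    then have "eventually (\<lambda>_. False) (inf (filtercomap g (nhds f)) sequentially)"
      by (simp add: H_def)
    then obtain P Q where PQ: "eventually P (nhds f)" "eventually Q sequentially"
      "\<And>j. P (g j) \<Longrightarrow> Q j \<Longrightarrow> False"
      unfolding eventually_inf eventually_filtercomap by blast
    have "eventually (\<lambda>h. \<not> P h) (filtermap g sequentially)"
      unfolding eventually_filtermap by (rule eventually_mono[OF PQ(2)]) (use PQ(3) in blast)
    then have "eventually (\<lambda>_. False) (inf (nhds f) (filtermap g sequentially))"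
      unfolding eventually_inf
      by (intro exI[of _ P] exI[of _ "\<lambda>h. \<not> P h"]) (simp add: PQ(1))
    with f show False by (simp add: eventually_False)
  qed
  moreover have "H \<le> sequentially" by (simp add: H_def)
  moreover have gf: "(g \<longlongrightarrow> f) H"
    unfolding H_def by (rule filterlim_mono[OF filterlim_filtercomap order_refl inf_le1])
  have "((\<lambda>j. g j A) \<longlongrightarrow> f A) H" for A
  proof -
    show ?thesis
      by (rule continuous_on_tendsto_compose[OF continuous_on_product_coordinates gf]) simp_all
  qed
  ultimately show thesis by (rule that)
qed

text \<open>
  Cluster points of the visit frequencies along longer and longer orbit segments are invariant
  measures, since shifting a segment of length \<open>n\<close> by one step changes frequencies by at most \<open>1 / n\<close>.
  The bound \<open>j < n j\<close> serves to make the lengths tend to infinity.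
\<close>

lemma krylov_bogoliubov:
  fixes S :: "'a::topological_space \<Rightarrow> 'a"
  assumes cantor: "cantor_space TYPE('a)" and S: "continuous_on UNIV S"
    and n: "\<And>j. j < n j"
  obtains H :: "nat filter" and \<mu> where "H \<noteq> bot" "\<mu> \<in> invariant_measures S"
    "\<And>A. clopen A \<Longrightarrow> ((\<lambda>j. visit_frequency S (n j) (x j) A) \<longlongrightarrow> measure \<mu> A) H"
proof -
  let ?g = "\<lambda>j. visit_frequency S (n j) (x j)"
  obtain H f where H: "H \<noteq> bot" "H \<le> sequentially" "\<And>A. ((\<lambda>j. ?g j A) \<longlongrightarrow> f A) H"
    by (rule cluster_point_in_unit_cube[of ?g]) (auto simp: visit_frequency_bounds)
  have n0: "n j > 0" for j using n[of j] by simp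
  have f1: "f UNIV = 1"
    by (rule tendsto_unique[OF H(1) H(3)]) (simp add: visit_frequency_def less_imp_neq[OF n0, symmetric])
  have f0: "f {} = 0"
    by (rule tendsto_unique[OF H(1) H(3)]) (simp add: visit_frequency_def)
  have f_pos: "0 \<le> f A" for A
    by (rule tendsto_lowerbound[OF H(3) always_eventually H(1)]) (simp add: visit_frequency_bounds)
  have f_add: "f (A \<union> B) = f A + f B" if "A \<inter> B = {}" for A B
  proof (rule tendsto_unique[OF H(1) H(3)])
    have "indicator (A \<union> B) y = indicator A y + (indicator B y :: real)" for y
      using that by (auto simp: indicator_def)
    then have "?g j (A \<union> B) = ?g j A + ?g j B" for j
      by (simp add: visit_frequency_def sum.distrib add_divide_distrib)
    then show "((\<lambda>j. ?g j (A \<union> B)) \<longlongrightarrow> f A + f B) H"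
      using tendsto_add[OF H(3)[of A] H(3)[of B]] by simp
  qed
  have f_inv: "f (S -` A) = f A" for A
  proof -
    have "((\<lambda>j. ?g j (S -` A) - ?g j A) \<longlongrightarrow> 0) sequentially"
    proof (rule Lim_null_comparison[OF always_eventually])
      show "\<forall>j. norm (?g j (S -` A) - ?g j A) \<le> inverse (real (Suc j))"
      proof
        fix j
        have "1 / real (n j) \<le> 1 / real (Suc j)" using n[of j] by (intro divide_left_mono) auto
        then show "norm (?g j (S -` A) - ?g j A) \<le> inverse (real (Suc j))"
          using visit_frequency_invariance[of S "n j" "x j" A]
          by (simp only: real_norm_def inverse_eq_divide)
      qed
    qed (rule LIMSEQ_inverse_real_of_nat)
    then have "((\<lambda>j. ?g j (S -` A) - ?g j A) \<longlongrightarrow> 0) H" using H(2) by (rule tendsto_mono[rotated])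
    moreover have "((\<lambda>j. ?g j (S -` A) - ?g j A) \<longlongrightarrow> f (S -` A) - f A) H"
      by (intro tendsto_diff H(3))
    ultimately have "f (S -` A) - f A = 0" using tendsto_unique[OF H(1)] by blast
    then show ?thesis by simp
  qed
  obtain \<mu> where \<mu>: "prob_space \<mu>" "sets \<mu> = sets borel" "\<And>A. clopen A \<Longrightarrow> measure \<mu> A = f A"
    by (rule clopen_content_extends[OF cantor f_pos f0 f1 f_add]) blast+
  have "\<mu> \<in> invariant_measures S"
    by (rule invariant_measures_clopenI[OF cantor S \<mu>(1,2)]) (simp add: \<mu>(3) clopen_vimage[OF S] f_inv)
  then show thesis using that[OF H(1)] H(3) \<mu>(3) by simp
qed

text \<open>
  Equal integrals for all invariant measures force uniform convergence of averages: segments that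
  violate it would have a cluster point among the invariant measures with a different integral. The
  function averaged here is the sum of the indicators of the sets \<open>A i\<close>.
\<close>

lemma uniform_visit_frequencies:
  fixes S :: "'a::topological_space \<Rightarrow> 'a"
  assumes cantor: "cantor_space TYPE('a)" and S: "continuous_on UNIV S"
    and A: "\<And>i. i \<in> I \<Longrightarrow> clopen (A i)"
    and a: "\<And>\<mu>. \<mu> \<in> invariant_measures S \<Longrightarrow> (\<Sum>i\<in>I. measure \<mu> (A i)) = a"
    and "\<epsilon> > 0"
  shows "\<forall>\<^sub>F n in sequentially. \<forall>x. \<bar>(\<Sum>i\<in>I. visit_frequency S n x (A i)) - a\<bar> < \<epsilon>"
proof (rule ccontr)
  assume "\<not> ?thesis"
  then have "\<forall>j. \<exists>n x. j < n \<and> \<epsilon> \<le> \<bar>(\<Sum>i\<in>I. visit_frequency S n x (A i)) - a\<bar>"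
    unfolding eventually_at_top_dense by (metis not_le)
  then obtain n x where n: "\<And>j. j < n j"
    and x: "\<And>j. \<epsilon> \<le> \<bar>(\<Sum>i\<in>I. visit_frequency S (n j) (x j) (A i)) - a\<bar>" by metis
  obtain H :: "nat filter" and \<mu> where H: "H \<noteq> bot" "\<mu> \<in> invariant_measures S"
    "\<And>A. clopen A \<Longrightarrow> ((\<lambda>j. visit_frequency S (n j) (x j) A) \<longlongrightarrow> measure \<mu> A) H"
    by (rule krylov_bogoliubov[OF cantor S n, of x]) blast
  have "((\<lambda>j. \<bar>(\<Sum>i\<in>I. visit_frequency S (n j) (x j) (A i)) - a\<bar>) \<longlongrightarrow>
      \<bar>(\<Sum>i\<in>I. measure \<mu> (A i)) - a\<bar>) H"
    by (intro tendsto_intros H(3) A)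
  then have "\<epsilon> \<le> \<bar>(\<Sum>i\<in>I. measure \<mu> (A i)) - a\<bar>"
    using x by (intro tendsto_lowerbound[OF _ _ H(1)]) auto
  with a[OF H(2)] \<open>\<epsilon> > 0\<close> show False by simp
qed

section \<open>Speedups of minimal Cantor systems\<close>

lemma minimal_invariant_closed_set:
  assumes "minimal_cantor_system T" "closed A" "x \<in> A" "\<And>y. T y \<in> A \<longleftrightarrow> y \<in> A"
  shows "A = UNIV"
proof -
  have bij: "bij T"
    using assms(1) by (simp add: minimal_cantor_system_def self_homeomorphismD)
  have pow: "(T ^^ n) y \<in> A \<longleftrightarrow> y \<in> A" for n y
    by (induction n) (simp_all add: assms(4))
  have "full_orbit T x \<subseteq> A"
    using assms(3) pow by (auto simp: full_orbit_iff[OF bij])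
  then have "closure (full_orbit T x) \<subseteq> A" using assms(2) by (rule closure_minimal)
  then show ?thesis using assms(1) by (auto simp: minimal_cantor_system_def)
qed

text \<open>
  A periodic orbit would be finite and closed, hence the whole space, which is infinite.
\<close>

lemma minimal_aperiodic:
  fixes T :: "'a::topological_space \<Rightarrow> 'a"
  assumes "minimal_cantor_system T" "(T ^^ n) x = x"
  shows "n = 0"
proof (rule ccontr)
  assume "n \<noteq> 0"
  have cantor: "cantor_space TYPE('a)" and bij: "bij T"
    using assms(1) by (simp_all add: minimal_cantor_system_def self_homeomorphismD)
  let ?O = "(\<lambda>i. (T ^^ i) x) ` {..<n}"
  have "T ` ?O \<subseteq> ?O"
  proof clarify
    fix i assume "i < n"
    then consider "Suc i < n" | "Suc i = n" by fastforce
    then show "T ((T ^^ i) x) \<in> ?O"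
    proof cases
      case 1
      then show ?thesis by (intro image_eqI[of _ _ "Suc i"]) simp_all
    next
      case 2
      then have "T ((T ^^ i) x) = x" using assms(2) by auto
      then show ?thesis using \<open>n \<noteq> 0\<close> by (intro image_eqI[of _ _ 0]) simp_all
    qed
  qed
  moreover have "inj_on T ?O" using bij by (meson bij_is_inj inj_on_subset subset_UNIV)
  ultimately have TO: "T ` ?O = ?O" by (intro endo_inj_surj) simp_all
  have "?O = UNIV"
  proof (rule minimal_invariant_closed_set[OF assms(1)])
    have "closed (\<Union>i\<in>{..<n}. {(T ^^ i) x})"
      by (intro closed_UN) (auto intro: cantor_space_closed_singleton[OF cantor])
    then show "closed ?O" by (simp add: UNION_singleton_eq_range)
    show "x \<in> ?O" using \<open>n \<noteq> 0\<close> by (intro image_eqI[of _ _ 0]) simp_all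
    show "T y \<in> ?O \<longleftrightarrow> y \<in> ?O" for y
      using TO inj_image_mem_iff[OF bij_is_inj[OF bij], of y ?O] by simp
  qed
  then have "finite (UNIV :: 'a set)" by (metis finite_imageI finite_lessThan)
  then show False using cantor_space_infinite[OF cantor] by simp
qed

locale minimal_speedup = bounded_speedup T S p P
  for T S :: "'a::topological_space \<Rightarrow> 'a" and p :: "'a \<Rightarrow> nat" and P :: nat +
  assumes minimal: "minimal_cantor_system T" and homeomorphism_S: "self_homeomorphism S"
begin

lemma cantor: "cantor_space TYPE('a)"
  and continuous_T: "continuous_on UNIV T" and continuous_inv_T: "continuous_on UNIV (inv T)"
  and continuous_S: "continuous_on UNIV S"
  using minimal homeomorphism_S
  by (simp_all add: minimal_cantor_system_def self_homeomorphismD)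

text \<open>
  As \<open>T\<close> is aperiodic, the level sets of \<open>p\<close> are equalizers of \<open>S\<close> with powers of \<open>T\<close> and so closed.
  Finitely many of them partition the space, so each is open as well.
\<close>

lemma p_level_clopen: "clopen (p -` {k})"
proof -
  have cl: "closed (p -` {k})" for k
    using cantor_space_closed_equalizer[OF cantor continuous_S continuous_funpow[OF continuous_T], of k]
    by (simp add: p_eq_iff vimage_def)
  have "- (p -` {k}) = (\<Union>j\<in>{..P} - {k}. p -` {j})" using p_le by auto
  then have "closed (- (p -` {k}))" using cl by (simp only:) (intro closed_UN; simp)
  then show ?thesis using cl by (simp add: clopen_def open_closed)
qed

lemma p_tail_clopen: "clopen {y. k < p y}"
proof -
  have "{y. k < p y} = (\<Union>j\<in>{k<..P}. p -` {j})" using p_le by auto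
  then show ?thesis using clopen_UN[of "{k<..P}" "\<lambda>j. p -` {j}"] p_level_clopen by simp
qed

lemma p_tail_image_clopen: "clopen ((T ^^ k) ` {y. k < p y})"
proof -
  have b: "bij (T ^^ k)" by (rule bij_fn[OF bij_T])
  have "inv (T ^^ k) -` {y. k < p y} = (T ^^ k) ` {y. k < p y}"
    by (simp only: bij_vimage_eq_inv_image[OF bij_imp_bij_inv[OF b]] inv_inv_eq[OF b])
  then show ?thesis
    using clopen_vimage[OF continuous_funpow[OF continuous_inv_T] p_tail_clopen, of k k]
    by (simp only: inv_fn[OF bij_T])
qed

text \<open>
  The number of jumps over the cut after \<open>x\<close> is a locally constant function of \<open>x\<close> that is invariant
  under \<open>T\<close>. By minimality it is constant, and its value is the orbit number.
\<close>

lemma crossing_card_eq: "card (crossing x) = orbit_number T S"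
proof -
  define B where "B k = (T ^^ k) ` {y. k < p y}" for k
  have B: "clopen (B k)" for k unfolding B_def by (rule p_tail_image_clopen)
  have card_crossing: "card (crossing y) = card {k\<in>{..<P}. y \<in> B k}" for y
    unfolding crossing_card B_def[symmetric] by (simp add: sum_of_bool_eq Int_def)
  define A where "A = {y. card (crossing y) = card (crossing x)}"
  have "A = UNIV"
  proof (rule minimal_invariant_closed_set[OF minimal])
    let ?\<K> = "{K. K \<subseteq> {..<P} \<and> card K = card (crossing x)}"
    \<comment> \<open>\<open>C K\<close> consists of the points whose cut is jumped over exactly from the distances in \<open>K\<close>.\<close>
    define C where "C K = (\<Inter>k\<in>K. B k) \<inter> (\<Inter>k\<in>{..<P} - K. - B k)" for K
    have "y \<in> A \<longleftrightarrow> (\<exists>K\<in>?\<K>. y \<in> C K)" for y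
    proof -
      have C: "y \<in> C K \<longleftrightarrow> {k\<in>{..<P}. y \<in> B k} = K" if "K \<subseteq> {..<P}" for K
        using that unfolding C_def by auto
      let ?K = "{k\<in>{..<P}. y \<in> B k}"
      have "?K \<subseteq> {..<P}" by auto
      then show ?thesis using C[of ?K] C by (auto simp: A_def card_crossing)
    qed
    then have "A = (\<Union>K\<in>?\<K>. C K)" by (intro set_eqI) (simp only: UN_iff)
    moreover have "clopen (C K)" if "K \<in> ?\<K>" for K
      unfolding C_def using that
      by (intro clopen_Int clopen_INT clopen_Compl B) (auto intro: finite_subset)
    then have "clopen (\<Union>K\<in>?\<K>. C K)"
      by (intro clopen_UN) auto
    ultimately show "closed A" by (simp add: clopen_def)
    show "x \<in> A" by (simp add: A_def)
    show "T y \<in> A \<longleftrightarrow> y \<in> A" for y by (simp add: A_def crossing_step)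
  qed
  then have "y \<in> A" for y by simp
  then have "card (crossing y) = card (crossing x)" for y by (simp add: A_def)
  from orbit_number_eq[OF this] show ?thesis by simp
qed

text \<open>
  A variant of Kac's formula: the integral of \<open>p\<close>, written as a sum over its tails, is the orbit number.
  Translating the \<open>k\<close>-th tail by \<open>T ^^ k\<close> does not change its measure, and after the translations the
  indicators add up to the number of jumps over the cut, which is constant.
\<close>

lemma kac_formula:
  assumes "\<mu> \<in> invariant_measures T"
  shows "(\<Sum>k<P. measure \<mu> {y. k < p y}) = real (orbit_number T S)"
proof -
  let ?B = "\<lambda>k. (T ^^ k) ` {y. k < p y}"
  interpret prob_space \<mu> using assms by (simp add: invariant_measures_def)
  have sets: "sets \<mu> = sets borel"
    and inv: "\<And>A. A \<in> sets borel \<Longrightarrow> emeasure \<mu> (T -` A) = emeasure \<mu> A"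
    using assms by (auto simp: invariant_measures_def)
  have sp: "space \<mu> = UNIV" using sets_eq_imp_space_eq[OF sets] by simp
  have B: "?B k \<in> sets borel" for k using p_tail_image_clopen[of k] by (simp add: clopen_def)
  have inv_pow: "measure \<mu> ((T ^^ n) -` A) = measure \<mu> A" if "A \<in> sets borel" for n A
    using that
  proof (induction n arbitrary: A)
    case (Suc n)
    have "T -` A \<in> sets borel"
      using measurable_sets[OF borel_measurable_continuous_onI[OF continuous_T] Suc.prems] by simp
    then have "measure \<mu> ((T ^^ n) -` (T -` A)) = measure \<mu> A"
      using Suc.IH inv[OF Suc.prems] by (simp add: measure_def)
    then show ?case by (simp add: vimage_def)
  qed simp
  have crossings: "(\<Sum>k<P. indicator (?B k) x) = real (orbit_number T S)" for x
    unfolding crossing_card_eq[symmetric, of x] crossing_card of_nat_sum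
    by (intro sum.cong) (simp_all add: indicator_def)
  have "measure \<mu> {y. k < p y} = measure \<mu> (?B k)" for k
    using inv_pow[OF B[of k], of k] inj_vimage_image_eq[OF inj_fn[OF bij_is_inj[OF bij_T]]] by simp
  then have "(\<Sum>k<P. measure \<mu> {y. k < p y}) = (\<Sum>k<P. \<integral>x. indicator (?B k) x \<partial>\<mu>)" by (simp add: sp)
  also have "\<dots> = (\<integral>x. (\<Sum>k<P. indicator (?B k) x) \<partial>\<mu>)"
    by (intro Bochner_Integration.integral_sum[symmetric] integrable_real_indicator)
       (auto simp: sets B emeasure_eq_measure)
  also have "\<dots> = (\<integral>x. real (orbit_number T S) \<partial>\<mu>)"
    by (simp only: crossings)
  finally show ?thesis by (simp add: prob_space)
qed

lemma time_eq_visit_frequency: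
  "real (time n x) / real n = (\<Sum>k<P. visit_frequency S n x {y. k < p y})"
proof -
  have "(\<Sum>k<P. indicator {y. k < p y} y) = real (p y)" for y
  proof -
    have "{..<P} \<inter> {k. k < p y} = {..<p y}" using p_le[of y] by auto
    then show ?thesis by (simp add: indicator_def sum_of_bool_eq flip: of_bool_def)
  qed
  then have "real (time n x) = (\<Sum>i<n. \<Sum>k<P. indicator {y. k < p y} ((S ^^ i) x))"
    by (simp add: time_def)
  also have "\<dots> = (\<Sum>k<P. \<Sum>i<n. indicator {y. k < p y} ((S ^^ i) x))" by (rule sum.swap)
  finally show ?thesis by (simp add: visit_frequency_def sum_divide_distrib)
qed

text \<open>
  Here equality of the two sets of invariant measures enters: averages along \<open>S\<close> are controlled by
  \<open>S\<close>-invariant measures, while the integral of \<open>p\<close> is known for \<open>T\<close>-invariant ones. Uniformity permits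
  choosing, for each \<open>n\<close>, any starting point for the orbit segment.
\<close>

lemma extremal_time_limits:
  assumes "invariant_measures T = invariant_measures S"
    and "\<And>n. \<exists>x. m n = time n x"
  shows "(\<lambda>n. real (m n) / real n) \<longlonglongrightarrow> real (orbit_number T S)"
proof (rule LIMSEQ_I)
  fix \<epsilon> :: real assume "\<epsilon> > 0"
  have "\<forall>\<^sub>F n in sequentially. \<forall>x. \<bar>real (time n x) / real n - real (orbit_number T S)\<bar> < \<epsilon>"
    unfolding time_eq_visit_frequency
    by (rule uniform_visit_frequencies[OF cantor continuous_S p_tail_clopen _ \<open>\<epsilon> > 0\<close>])
       (use kac_formula assms(1) in blast)
  then have "\<forall>\<^sub>F n in sequentially. \<bar>real (m n) / real n - real (orbit_number T S)\<bar> < \<epsilon>"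
    by eventually_elim (use assms(2) in metis)
  then show "\<exists>N. \<forall>n\<ge>N. norm (real (m n) / real n - real (orbit_number T S)) < \<epsilon>"
    by (simp add: eventually_sequentially)
qed

text \<open>
  In \<open>n\<close> steps of \<open>S\<close>, time under \<open>T\<close> advances by at least \<open>m n\<close> and at most \<open>M n\<close>. The upper bound for the
  entropy of \<open>S\<close> reads \<open>S\<close>-itineraries off \<open>T\<close>-itineraries of length \<open>M n\<close>; the lower bound reads
  \<open>T\<close>-itineraries of length \<open>m n\<close> off \<open>S\<close>-itineraries.
\<close>

lemma topological_entropy_speedup:
  assumes inv: "invariant_measures T = invariant_measures S"
  shows "topological_entropy S = ereal (real (orbit_number T S)) * topological_entropy T"
proof (rule antisym)
  let ?c = "ereal (real (orbit_number T S))"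
  note compact = cantor_space_compact[OF cantor]
  have fin: "finite (range (time n))" for n
    by (rule finite_subset[of _ "{..n * P}"]) (use time_le in auto)
  define m where "m n = Min (range (time n))" for n
  define M where "M n = Max (range (time n))" for n
  have m: "m n \<le> time n x" and M: "time n x \<le> M n" for n x
    using fin[of n] by (auto simp: m_def M_def)
  have m_ex: "\<exists>x. m n = time n x" and M_ex: "\<exists>x. M n = time n x" for n
    using Min_in[OF fin[of n]] Max_in[OF fin[of n]] by (auto simp: m_def M_def)
  have to_top: "filterlim m at_top sequentially" "filterlim M at_top sequentially"
    using m_ex M_ex le_time by (intro filterlim_at_top_mono[OF filterlim_ident] always_eventually; metis)+
  note limits = extremal_time_limits[OF inv m_ex] extremal_time_limits[OF inv M_ex]
  note refine = label_refinement_open_covers[OF _ p_level_clopen[unfolded clopen_def, THEN conjunct1]]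
  have ne: "\<U> \<noteq> {}" if "\<U> \<in> open_covers" for \<U> :: "'a set set"
    using that by (auto simp: open_covers_def)
  show "topological_entropy S \<le> ?c * topological_entropy T"
    unfolding topological_entropy_def[of S]
  proof (rule SUP_least)
    fix \<U> :: "'a set set" assume U: "\<U> \<in> open_covers"
    note V = refine[OF U]
    have "min_subcover (iterated_join S \<U> n) \<le> min_subcover (iterated_join T (label_refinement p \<U>) (M n))" for n
      by (rule min_subcover_refinement[OF compact iterated_join_open_covers[OF continuous_T V]])
         (rule T_join_refines_S_join[OF _ M ne[OF U]])
    then have "cover_entropy S \<U> \<le> ?c * cover_entropy T (label_refinement p \<U>)"
      by (rule cover_entropy_time_change_ge[OF compact continuous_T continuous_S V U to_top(2) limits(2)])
    also have "\<dots> \<le> ?c * topological_entropy T"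
      unfolding topological_entropy_def by (intro ereal_mult_left_mono SUP_upper V) simp
    finally show "cover_entropy S \<U> \<le> ?c * topological_entropy T" .
  qed
  have "?c * cover_entropy T \<U> \<le> topological_entropy S" if U: "\<U> \<in> open_covers" for \<U>
  proof -
    let ?V = "label_refinement p (iterated_join T \<U> P)"
    note V = refine[OF iterated_join_open_covers[OF continuous_T U, of P]]
    have "min_subcover (iterated_join T \<U> (m n)) \<le> min_subcover (iterated_join S ?V n)" for n
      by (rule min_subcover_refinement[OF compact iterated_join_open_covers[OF continuous_S V]])
         (rule S_join_refines_T_join[OF _ m ne[OF U]])
    then have "?c * cover_entropy T \<U> \<le> cover_entropy S ?V"
      by (rule cover_entropy_time_change_le[OF compact continuous_T continuous_S U V to_top(1) limits(1)])
    also have "\<dots> \<le> topological_entropy S"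
      unfolding topological_entropy_def by (rule SUP_upper[OF V])
    finally show ?thesis .
  qed
  then have "(SUP \<U>\<in>open_covers. ?c * cover_entropy T \<U>) \<le> topological_entropy S"
    by (rule SUP_least)
  moreover have "{UNIV} \<in> (open_covers :: 'a set set set)"
    by (auto simp: open_covers_def)
  then have "(open_covers :: 'a set set set) \<noteq> {}" by blast
  then have "(SUP \<U>\<in>open_covers. ?c * cover_entropy T \<U>) = ?c * topological_entropy T"
    unfolding topological_entropy_def[of T] by (subst Sup_ereal_mult_left') simp_all
  ultimately show "?c * topological_entropy T \<le> topological_entropy S" by simp
qed

end

theorem corollary2p13:
  fixes T S :: "'a::topological_space \<Rightarrow> 'a"
    and p :: "'a \<Rightarrow> nat"
  assumes "minimal_cantor_system T"
    and "\<And>x. p x > 0"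
    and "bdd_above (range p)"
    and "\<And>x. S x = (T ^^ p x) x"
    and "self_homeomorphism S"
    and "invariant_measures T = invariant_measures S"
  shows "topological_entropy S = ereal (real (orbit_number T S)) * topological_entropy T"
proof -
  obtain P where P: "\<And>x. p x \<le> P" using assms(3) by (auto simp: bdd_above_def)
  interpret minimal_speedup T S p P
  proof
    show "bij T" "bij S"
      using assms(1,5) by (simp_all add: minimal_cantor_system_def self_homeomorphismD)
    show "n = 0" if "(T ^^ n) x = x" for n x by (rule minimal_aperiodic[OF assms(1) that])
  qed (use assms P in blast)+
  show ?thesis by (rule topological_entropy_speedup[OF assms(6)])
qed

end
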